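(* Let $k\ge5$ be odd. There is a constant $c_k>0$ such that for all $0<\alpha<1/2$, $\widetilde\rho_k(\alpha)\le\alpha^{c_k\log(1/\alpha)}$.
   Context: $\mathbb{T}=\mathbb{R}/\mathbb{Z}$. A function $F\colon\mathbb{T}^2\to[0,1]$ has constant first marginal $\alpha$ if $\int_\mathbb{T}F(x,y)\,dy=\alpha$ for a.e. $x$. $\widetilde\Lambda_k(F)=\mathbb{E}_{(x,y)\in V}\prod_{i=1}^kF(x_i,y_i)$ (Haar measure on $V$), where $V\subset\mathbb{T}^{2k}$ consists of $(x_1,\dots,x_k,y_1,\dots,y_k)$ with $x_2-x_1=\cdots=x_k-x_{k-1}$ and $\sum_{i=1}^k(-1)^i\binom{k-1}{i-1}y_i=0$. $\widetilde\rho_k(\alpha)$ is the infimum of $\widetilde\Lambda_k(F)$ over Riemann integrable $F\colon\mathbb{T}^2\to[0,1]$ with constant first marginal $\alpha$. *)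

theory Defs
  imports "HOL-Probability.Probability"
begin

section \<open>The circle group \<open>\<real>/\<int>\<close>\<close>

quotient_type circle = real / "\<lambda>x y :: real. x - y \<in> \<int>"
  morphisms rep_circle to_circle
proof (rule equivpI)
  show "reflp (\<lambda>x y :: real. x - y \<in> \<int>)"
    by (simp add: reflp_def)
  show "symp (\<lambda>x y :: real. x - y \<in> \<int>)"
    by (rule sympI) (metis Ints_minus minus_diff_eq)
  show "transp (\<lambda>x y :: real. x - y \<in> \<int>)"
  proof (rule transpI)
    fix x y z :: real
    assume "x - y \<in> \<int>" "y - z \<in> \<int>"
    then have "(x - y) + (y - z) \<in> \<int>" by (rule Ints_add)
    then show "x - z \<in> \<int>" by simp
  qed
qed

instantiation circle :: ab_group_add
begin

lift_definition zero_circle :: circle is "0 :: real" .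

lift_definition plus_circle :: "circle \<Rightarrow> circle \<Rightarrow> circle" is "(+) :: real \<Rightarrow> real \<Rightarrow> real"
  unfolding add_diff_add by (rule Ints_add)

lift_definition uminus_circle :: "circle \<Rightarrow> circle" is "uminus :: real \<Rightarrow> real"
  unfolding minus_diff_minus by (rule Ints_minus)

lift_definition minus_circle :: "circle \<Rightarrow> circle \<Rightarrow> circle" is "(-) :: real \<Rightarrow> real \<Rightarrow> real"
  subgoal for a b c d using Ints_diff[of "a - b" "c - d"] by (simp add: algebra_simps)
  done

instance
  by standard (transfer; simp add: algebra_simps)+

end

lift_definition int_scale :: "int \<Rightarrow> circle \<Rightarrow> circle" is "\<lambda>n x. of_int n * x"
  unfolding right_diff_distrib[symmetric] by (intro Ints_mult Ints_of_int)

lemma module_int_scale: "module int_scale"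
  by standard (transfer; simp add: algebra_simps)+

text \<open>The quotient topology.\<close>

instantiation circle :: topological_space
begin

definition open_circle :: "circle set \<Rightarrow> bool"
  where "open_circle U \<longleftrightarrow> open (to_circle -` U)"

instance
  by standard (auto simp: open_circle_def vimage_Union intro!: open_INT open_UN open_Int)

end

lemma continuous_to_circle: "continuous_on UNIV to_circle"
  by (simp add: continuous_on_open_vimage open_circle_def)

text \<open>The Haar probability measure of the circle: the image of Lebesgue measure on \<open>[0,1]\<close>.\<close>

definition circle_measure :: "circle measure"
  where "circle_measure = distr (restrict_space lborel {0..1}) borel to_circle"

section \<open>Functions on the two-dimensional torus\<close>

text \<open>
  Riemann integrability over a box in the sense of convergence of Riemann sums as the mesh of the
  tagged partition tends to zero; this is the Henstock--Kurzweil definition with constant gauges.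
\<close>

definition riemann_integrable_cbox :: "('a::euclidean_space \<Rightarrow> real) \<Rightarrow> 'a \<Rightarrow> 'a \<Rightarrow> bool"
  where "riemann_integrable_cbox f a b \<longleftrightarrow>
    (\<exists>I. \<forall>e>0. \<exists>d>0. \<forall>D. D tagged_division_of cbox a b \<and> (\<lambda>x. ball x d) fine D \<longrightarrow>
       \<bar>(\<Sum>(x, K)\<in>D. measure lborel K * f x) - I\<bar> < e)"

definition riemann_integrable_torus :: "(circle \<times> circle \<Rightarrow> real) \<Rightarrow> bool"
  where "riemann_integrable_torus F \<longleftrightarrow>
    riemann_integrable_cbox (\<lambda>(s, t). F (to_circle s, to_circle t)) (0 :: real \<times> real) (1, 1)"

text \<open>
  The completion is needed since a Riemann integrable function is Lebesgue measurable but in general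
  not Borel measurable.
\<close>

definition constant_first_marginal :: "(circle \<times> circle \<Rightarrow> real) \<Rightarrow> real \<Rightarrow> bool"
  where "constant_first_marginal F \<alpha> \<longleftrightarrow>
    (AE x in circle_measure. has_bochner_integral (completion circle_measure) (\<lambda>y. F (x, y)) \<alpha>)"

section \<open>The group \<open>V\<close> and its Haar measure\<close>

text \<open>
  A point of the \<open>2k\<close>-dimensional torus is a pair \<open>(x, y)\<close> of functions on \<open>{1..k}\<close>, extended by
  \<open>undefined\<close> outside of \<open>{1..k}\<close>. As the circle is second countable, the product of the Borel
  sigma-algebras below is the Borel sigma-algebra of the torus.
\<close>

type_synonym torus_point = "(nat \<Rightarrow> circle) \<times> (nat \<Rightarrow> circle)"

definition torus_borel :: "nat \<Rightarrow> torus_point measure"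
  where "torus_borel k = PiM {1..k} (\<lambda>_. borel) \<Otimes>\<^sub>M PiM {1..k} (\<lambda>_. borel)"

definition torus_add :: "nat \<Rightarrow> torus_point \<Rightarrow> torus_point \<Rightarrow> torus_point"
  where "torus_add k = (\<lambda>(x, y) (x', y'). (\<lambda>i\<in>{1..k}. x i + x' i, \<lambda>i\<in>{1..k}. y i + y' i))"

definition V :: "nat \<Rightarrow> torus_point set"
  where "V k = {(x, y). x \<in> {1..k} \<rightarrow>\<^sub>E UNIV \<and> y \<in> {1..k} \<rightarrow>\<^sub>E UNIV \<and>
    (\<exists>d. \<forall>i\<in>{1..<k}. x (i + 1) - x i = d) \<and>
    (\<Sum>i=1..k. int_scale ((-1) ^ i * int ((k - 1) choose (i - 1))) (y i)) = 0}"

definition is_haar_V :: "nat \<Rightarrow> torus_point measure \<Rightarrow> bool"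
  where "is_haar_V k \<mu> \<longleftrightarrow>
    prob_space \<mu> \<and> sets \<mu> = sets (restrict_space (torus_borel k) (V k)) \<and>
    (\<forall>v\<in>V k. \<forall>A\<in>sets \<mu>. emeasure \<mu> (torus_add k v ` A) = emeasure \<mu> A)"

text \<open>Well defined for \<open>k \<ge> 1\<close>, see \<open>is_haar_V_unique\<close> and \<open>is_haar_V_haar_V\<close> below.\<close>

definition haar_V :: "nat \<Rightarrow> torus_point measure"
  where "haar_V k = (THE \<mu>. is_haar_V k \<mu>)"

section \<open>The pattern density\<close>

definition Lambda_tilde :: "nat \<Rightarrow> (circle \<times> circle \<Rightarrow> real) \<Rightarrow> real"
  where "Lambda_tilde k F = (\<integral>(x, y). (\<Prod>i=1..k. F (x i, y i)) \<partial>completion (haar_V k))"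

definition rho_tilde :: "nat \<Rightarrow> real \<Rightarrow> real"
  where "rho_tilde k \<alpha> = Inf {Lambda_tilde k F | F.
    range F \<subseteq> {0..1} \<and> riemann_integrable_torus F \<and> constant_first_marginal F \<alpha>}"

section \<open>Existence and uniqueness of the Haar measure of \<open>V\<close>\<close>

lemma to_circle_eq_iff: "to_circle x = to_circle y \<longleftrightarrow> x - y \<in> \<int>"
  by (rule circle.abs_eq_iff)

lemma to_circle_add: "to_circle (x + y) = to_circle x + to_circle y"
  by (simp add: plus_circle.abs_eq)

lemma to_circle_uminus: "to_circle (- x) = - to_circle x"
  by (simp add: uminus_circle.abs_eq)

lemma to_circle_measurable [measurable]: "to_circle \<in> borel_measurable borel"
  by (rule borel_measurable_continuous_onI[OF continuous_to_circle])

definition crep :: "circle \<Rightarrow> real" where "crep c = frac (rep_circle c)"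

lemma to_circle_frac: "to_circle (frac r) = to_circle r"
  by (simp add: to_circle_eq_iff frac_def)

lemma to_circle_rep: "to_circle (rep_circle c) = c"
  using Quotient3_circle by (simp add: Quotient3_abs_rep)

lemma to_circle_crep [simp]: "to_circle (crep c) = c"
  by (simp add: crep_def to_circle_frac to_circle_rep)

lemma crep_to_circle: "crep (to_circle r) = frac r"
proof -
  have "to_circle (crep (to_circle r)) = to_circle (frac r)"
    by (simp add: to_circle_frac)
  then have *: "crep (to_circle r) - frac r \<in> \<int>" by (simp only: to_circle_eq_iff)
  have "frac (crep (to_circle r)) = frac (frac r)"
    using * by (metis add.commute diff_add_cancel frac_in_Ints_iff frac_unique_iff crep_def
      frac_frac frac_ge_0 frac_lt_1 )
  then show ?thesis by (simp add: crep_def)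
qed

lemma crep_range: "0 \<le> crep c" "crep c < 1"
  by (simp_all add: crep_def frac_lt_1)

lemma open_to_circle_image: "open U \<Longrightarrow> open (to_circle ` U)"
proof -
  assume U: "open U"
  have "to_circle -` (to_circle ` U) = (\<Union>n::int. (\<lambda>x. of_int n + x) ` U)"
  proof (intro equalityI subsetI)
    fix x assume "x \<in> to_circle -` (to_circle ` U)"
    then obtain y where y: "to_circle x = to_circle y" "y \<in> U" by auto
    then obtain n where "x - y = of_int n" by (auto simp: to_circle_eq_iff elim: Ints_cases)
    then have "x = of_int n + y" by simp
    then show "x \<in> (\<Union>n::int. (\<lambda>x. of_int n + x) ` U)" using \<open>y \<in> U\<close> by blast
  next
    fix z assume "z \<in> (\<Union>n::int. (\<lambda>x. of_int n + x) ` U)"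
    then obtain n :: int and x where "x \<in> U" "z = of_int n + x" by auto
    then show "z \<in> to_circle -` (to_circle ` U)"
      by (auto intro!: image_eqI[of _ _ x] simp: to_circle_eq_iff)
  qed
  then show ?thesis
    using U by (auto simp: open_circle_def intro!: open_UN open_translation)
qed

lemma closed_zero_circle: "closed {0 :: circle}"
proof -
  have "to_circle -` (- {0}) = - \<int>"
    by (auto simp: zero_circle_def to_circle_eq_iff)
  then show ?thesis
    using closed_Ints by (simp add: closed_def open_circle_def)
qed

lemma crep_measurable [measurable]: "crep \<in> borel_measurable borel"
proof (rule borel_measurableI_less)
  fix a :: real
  have "{c. crep c < a} \<in> sets borel"
  proof -
    consider "a \<le> 0" | "a \<ge> 1" | "0 < a" "a < 1" by linarith
    then show ?thesis
    proof cases
      case 1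
      then have "{c. crep c < a} = {}" using crep_range(1) by (auto intro: order.trans simp: not_less)
      then show ?thesis by simp
    next
      case 2
      then have "{c. crep c < a} = UNIV" using crep_range(2) by (auto intro: less_le_trans)
      then show ?thesis by simp
    next
      case 3
      have "{c. crep c < a} = to_circle ` {0<..<a} \<union> {0}"
      proof (intro equalityI subsetI)
        fix c assume "c \<in> {c. crep c < a}"
        then have "crep c = 0 \<or> crep c \<in> {0<..<a}" using crep_range(1)[of c] by auto
        then show "c \<in> to_circle ` {0<..<a} \<union> {0}"
          by (metis UnI1 UnI2 image_eqI singletonI to_circle_crep zero_circle_def)
      next
        fix c assume "c \<in> to_circle ` {0<..<a} \<union> {0}"
        then have "\<exists>r. 0 \<le> r \<and> r < a \<and> c = to_circle r"
        proof
          assume "c \<in> to_circle ` {0<..<a}"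
          then obtain r where "r \<in> {0<..<a}" "c = to_circle r" by blast
          then show ?thesis by (intro exI[of _ r]) simp
        next
          assume "c \<in> {0}"
          then show ?thesis using 3 by (intro exI[of _ 0]) (simp add: zero_circle_def)
        qed
        then obtain r where "0 \<le> r" "r < a" "c = to_circle r" by blast
        then show "c \<in> {c. crep c < a}" using 3
          by (simp add: crep_to_circle frac_eq[THEN iffD2])
      qed
      moreover have "to_circle ` {0<..<a} \<in> sets borel"
        by (intro borel_open open_to_circle_image) auto
      moreover have "{0::circle} \<in> sets borel" by (rule borel_closed[OF closed_zero_circle])
      ultimately show ?thesis by (simp only: sets.Un)
    qed
  qed
  then show "{w \<in> space borel. crep w < a} \<in> sets borel" by simp
qed

lemma circle_add_measurable [measurable (raw)]:
  assumes [measurable]: "f \<in> borel_measurable M" "g \<in> borel_measurable M"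
  shows "(\<lambda>x. f x + g x :: circle) \<in> borel_measurable M"
proof -
  have "(\<lambda>x. to_circle (crep (f x) + crep (g x))) \<in> borel_measurable M" by measurable
  then show ?thesis by (simp add: to_circle_add)
qed

lemma circle_scale_measurable [measurable (raw)]:
  assumes [measurable]: "f \<in> borel_measurable M"
  shows "(\<lambda>x. int_scale n (f x)) \<in> borel_measurable M"
proof -
  have "(\<lambda>x. to_circle (of_int n * crep (f x))) \<in> borel_measurable M" by measurable
  then show ?thesis by (simp flip: int_scale.abs_eq)
qed

lemma circle_sum_measurable [measurable (raw)]:
  assumes [measurable]: "\<And>i. i \<in> I \<Longrightarrow> f i \<in> borel_measurable M"
  shows "(\<lambda>x. (\<Sum>i\<in>I. f i x) :: circle) \<in> borel_measurable M"
  using assms by (induction I rule: infinite_finite_induct) auto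

lemma sets_circle_measure [measurable_cong, simp]: "sets circle_measure = sets borel"
  and space_circle_measure [simp]: "space circle_measure = UNIV"
  by (simp_all add: circle_measure_def)

lemma emeasure_circle_measure:
  assumes "A \<in> sets borel"
  shows "emeasure circle_measure A = emeasure lborel (to_circle -` A \<inter> {0..<1})"
proof -
  have m: "to_circle -` A \<in> sets borel"
    using measurable_sets[OF to_circle_measurable assms] by simp
  have "to_circle \<in> measurable (restrict_space lborel {0..1}) borel"
    by (rule measurable_restrict_space1) simp
  then have "emeasure circle_measure A = emeasure lborel (to_circle -` A \<inter> {0..1})"
    using assms by (simp add: circle_measure_def emeasure_distr emeasure_restrict_space space_restrict_space)
  also have "\<dots> = emeasure lborel (to_circle -` A \<inter> {0..<1})"
  proof (rule emeasure_eq_AE)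
    have "AE x in lborel. x \<noteq> (1::real)" by (rule AE_lborel_singleton)
    then show "AE x in lborel. (x \<in> to_circle -` A \<inter> {0..1}) = (x \<in> to_circle -` A \<inter> {0..<1})"
      by eventually_elim auto
  qed (use m in auto)
  finally show ?thesis .
qed

lemma prob_space_circle_measure: "prob_space circle_measure"
proof
  show "emeasure circle_measure (space circle_measure) = 1"
    by (simp add: emeasure_circle_measure)
qed

lemma circle_measure_translate:
  assumes A: "A \<in> sets borel"
  shows "emeasure circle_measure ((+) c -` A) = emeasure circle_measure A"
proof -
  define r where "r = crep c"
  have r: "0 \<le> r" "r < 1" using crep_range by (auto simp: r_def)
  define B where "B = to_circle -` A"
  have B [measurable]: "B \<in> sets borel"
    using measurable_sets[OF to_circle_measurable A] by (simp add: B_def)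
  have per: "x + 1 \<in> B \<longleftrightarrow> x \<in> B" for x
  proof -
    have "to_circle (x + 1) = to_circle x" by (simp add: to_circle_eq_iff)
    then show ?thesis by (simp add: B_def)
  qed
  have shift: "emeasure lborel ((\<lambda>x. x + t) -` S) = emeasure lborel S"
    if "S \<in> sets borel" for S and t :: real
  proof -
    have "emeasure lborel S = emeasure (distr lborel borel ((+) t)) S"
      by (simp add: lborel_distr_plus)
    also have "\<dots> = emeasure lborel ((+) t -` S)"
      using that by (subst emeasure_distr) auto
    finally show ?thesis by (simp add: add.commute[of _ t])
  qed
  have cA: "(+) c -` A \<in> sets borel"
  proof -
    have "(\<lambda>x. c + x) \<in> borel_measurable borel" by measurable
    from measurable_sets[OF this A] show ?thesis by simp
  qed
  have "emeasure circle_measure ((+) c -` A) = emeasure lborel (to_circle -` ((+) c -` A) \<inter> {0..<1})"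
    by (rule emeasure_circle_measure[OF cA])
  also have "to_circle -` ((+) c -` A) \<inter> {0..<1} = (\<lambda>x. x + r) -` (B \<inter> {r..<1+r})"
  proof -
    have "c + to_circle x = to_circle (x + r)" for x
      by (simp add: to_circle_add r_def add.commute)
    then show ?thesis by (auto simp: B_def)
  qed
  also have "emeasure lborel \<dots> = emeasure lborel (B \<inter> {r..<1+r})" by (rule shift) auto
  also have "B \<inter> {r..<1+r} = (B \<inter> {r..<1}) \<union> (B \<inter> {1..<1+r})" using r by auto
  also have "emeasure lborel \<dots> = emeasure lborel (B \<inter> {r..<1}) + emeasure lborel (B \<inter> {1..<1+r})"
    by (rule plus_emeasure[symmetric]) auto
  also have "emeasure lborel (B \<inter> {1..<1+r}) = emeasure lborel ((\<lambda>x. x + 1) -` (B \<inter> {1..<1+r}))"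
    by (rule shift[symmetric]) auto
  also have "(\<lambda>x. x + 1) -` (B \<inter> {1..<1+r}) = B \<inter> {0..<r}" using per by auto
  also have "emeasure lborel (B \<inter> {r..<1}) + emeasure lborel (B \<inter> {0..<r})
     = emeasure lborel ((B \<inter> {r..<1}) \<union> (B \<inter> {0..<r}))"
    by (rule plus_emeasure) auto
  also have "(B \<inter> {r..<1}) \<union> (B \<inter> {0..<r}) = B \<inter> {0..<1}" using r by auto
  also have "emeasure lborel \<dots> = emeasure circle_measure A"
    by (simp add: emeasure_circle_measure[OF A] B_def)
  finally show ?thesis .
qed


lemma emeasure_PiM_translate:
  fixes q :: "nat \<Rightarrow> circle"
  assumes I: "finite I" and A: "A \<in> sets (PiM I (\<lambda>_. circle_measure))"
  shows "emeasure (PiM I (\<lambda>_. circle_measure))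
      ((\<lambda>p. \<lambda>i\<in>I. q i + p i) -` A \<inter> (I \<rightarrow>\<^sub>E UNIV)) = emeasure (PiM I (\<lambda>_. circle_measure)) A"
proof -
  interpret circle: prob_space circle_measure by (rule prob_space_circle_measure)
  interpret P: product_sigma_finite "\<lambda>_. circle_measure" by standard
  let ?N = "PiM I (\<lambda>_. circle_measure)" and ?t = "\<lambda>p. \<lambda>i\<in>I. q i + p i"
  have t [measurable]: "?t \<in> measurable ?N ?N" by measurable
  have "distr ?N ?N ?t = ?N"
  proof (rule P.PiM_eqI[OF I])
    show "sets (distr ?N ?N ?t) = sets ?N" by simp
    fix B :: "nat \<Rightarrow> circle set"
    assume B: "\<And>i. i \<in> I \<Longrightarrow> B i \<in> sets circle_measure"
    have tr: "(+) (q i) -` B i \<in> sets circle_measure" if "i \<in> I" for i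
    proof -
      have "(\<lambda>c. q i + c) \<in> borel_measurable borel" by measurable
      from measurable_sets[OF this, of "B i"] B[OF that] show ?thesis by simp
    qed
    have "emeasure (distr ?N ?N ?t) (PiE I B) = emeasure ?N (?t -` PiE I B \<inter> space ?N)"
      using B I by (intro emeasure_distr t sets_PiM_I_finite) auto
    also have "?t -` PiE I B \<inter> space ?N = PiE I (\<lambda>i. (+) (q i) -` B i)"
      by (auto simp: space_PiM PiE_iff)
    also have "emeasure ?N \<dots> = (\<Prod>i\<in>I. emeasure circle_measure ((+) (q i) -` B i))"
      using tr by (intro P.emeasure_PiM I) auto
    also have "\<dots> = (\<Prod>i\<in>I. emeasure circle_measure (B i))"
      using B by (intro prod.cong circle_measure_translate) auto
    finally show "emeasure (distr ?N ?N ?t) (PiE I B) = (\<Prod>i\<in>I. emeasure circle_measure (B i))" .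
  qed
  then have "emeasure ?N A = emeasure (distr ?N ?N ?t) A" by simp
  also have "\<dots> = emeasure ?N (?t -` A \<inter> space ?N)" using A by (intro emeasure_distr t)
  finally show ?thesis by (simp add: space_PiM)
qed

interpretation circle: module int_scale by (rule module_int_scale)

definition torus_neg :: "nat \<Rightarrow> torus_point \<Rightarrow> torus_point"
  where "torus_neg k = (\<lambda>(x, y). (\<lambda>i\<in>{1..k}. - x i, \<lambda>i\<in>{1..k}. - y i))"

lemma space_torus_borel: "space (torus_borel k) = ({1..k} \<rightarrow>\<^sub>E UNIV) \<times> ({1..k} \<rightarrow>\<^sub>E UNIV)"
  by (simp add: torus_borel_def space_pair_measure space_PiM)

lemma V_subset: "V k \<subseteq> space (torus_borel k)"
  by (auto simp: V_def space_torus_borel)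

lemma torus_add_V: "v \<in> V k \<Longrightarrow> w \<in> V k \<Longrightarrow> torus_add k v w \<in> V k"
  apply (clarsimp simp: V_def torus_add_def circle.scale_right_distrib sum.distrib)
  subgoal for x y x' y' d d'
    by (rule exI[of _ "d + d'"]) (simp add: add_diff_add)
  done

lemma torus_neg_V: "v \<in> V k \<Longrightarrow> torus_neg k v \<in> V k"
  apply (clarsimp simp: V_def torus_neg_def sum_negf)
  subgoal for x y d
    by (rule exI[of _ "- d"]) (metis minus_diff_eq)
  done

lemma torus_add_neg: "w \<in> V k \<Longrightarrow> torus_add k (torus_neg k v) (torus_add k v w) = w"
  "w \<in> V k \<Longrightarrow> torus_add k v (torus_add k (torus_neg k v) w) = w"
  by (cases v; cases w; simp add: V_def torus_add_def torus_neg_def PiE_iff extensional_def fun_eq_iff)+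

lemma image_torus_add:
  assumes v: "v \<in> V k" and A: "A \<subseteq> V k"
  shows "torus_add k v ` A = torus_add k (torus_neg k v) -` A \<inter> V k"
proof (intro equalityI subsetI)
  fix w assume "w \<in> torus_add k v ` A"
  then obtain u where u: "u \<in> A" "w = torus_add k v u" by blast
  moreover from u have "u \<in> V k" using A by blast
  ultimately show "w \<in> torus_add k (torus_neg k v) -` A \<inter> V k"
    using torus_add_V[OF v, of u] torus_add_neg(1)[of u k v] by simp
next
  fix w assume "w \<in> torus_add k (torus_neg k v) -` A \<inter> V k"
  then show "w \<in> torus_add k v ` A"
    using torus_add_neg(2)[of w k v] by (intro image_eqI[of _ _ "torus_add k (torus_neg k v) w"]) auto
qed

lemma torus_neg_neg: "v \<in> V k \<Longrightarrow> torus_neg k (torus_neg k v) = v"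
  by (cases v) (simp add: V_def torus_neg_def PiE_iff extensional_def fun_eq_iff)

lemma torus_add_commute: "torus_add k v w = torus_add k w v"
  by (cases v; cases w) (simp add: torus_add_def add.commute)

lemma torus_add_measurable:
  "(\<lambda>(v, w). torus_add k v w) \<in> measurable (torus_borel k \<Otimes>\<^sub>M torus_borel k) (torus_borel k)"
  unfolding torus_add_def torus_borel_def split_beta by measurable

lemma torus_add_measurable_V:
  "(\<lambda>(v, w). torus_add k v w) \<in> measurable
     (restrict_space (torus_borel k) (V k) \<Otimes>\<^sub>M restrict_space (torus_borel k) (V k))
     (restrict_space (torus_borel k) (V k))" (is "?f \<in> measurable (?R \<Otimes>\<^sub>M ?R) ?R")
proof (rule measurable_restrict_space2)
  show "?f \<in> space (?R \<Otimes>\<^sub>M ?R) \<rightarrow> V k"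
    using V_subset[of k] by (auto simp: space_pair_measure space_restrict_space torus_add_V)
  have i: "(\<lambda>x. x) \<in> measurable ?R (torus_borel k)" by (rule measurable_restrict_space1) simp
  have "(\<lambda>(v, w). (v, w)) \<in> measurable (?R \<Otimes>\<^sub>M ?R) (torus_borel k \<Otimes>\<^sub>M torus_borel k)"
    unfolding split_beta
    by (intro measurable_Pair measurable_compose[OF measurable_fst i] measurable_compose[OF measurable_snd i])
  from measurable_compose[OF this torus_add_measurable]
  show "?f \<in> measurable (?R \<Otimes>\<^sub>M ?R) (torus_borel k)" by (simp add: split_beta)
qed

lemma is_haar_V_space:
  assumes "is_haar_V k \<mu>"
  shows "space \<mu> = V k"
proof -
  have "space \<mu> = space (restrict_space (torus_borel k) (V k))"
    using assms unfolding is_haar_V_def by (intro sets_eq_imp_space_eq) auto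
  then show ?thesis using V_subset[of k] by (auto simp: space_restrict_space)
qed

lemma is_haar_V_translate:
  assumes h: "is_haar_V k \<mu>" and v: "v \<in> V k" and A: "A \<in> sets \<mu>"
  shows "emeasure \<mu> (torus_add k v -` A \<inter> V k) = emeasure \<mu> A"
proof -
  have "A \<subseteq> V k" using sets.sets_into_space[OF A] is_haar_V_space[OF h] by simp
  then have "torus_add k v -` A \<inter> V k = torus_add k (torus_neg k v) ` A"
    using image_torus_add[OF torus_neg_V[OF v], of A] torus_neg_neg[OF v] by simp
  then show ?thesis using h torus_neg_V[OF v] A by (simp add: is_haar_V_def)
qed

lemma is_haar_V_unique:
  assumes \<mu>: "is_haar_V k \<mu>" and \<nu>: "is_haar_V k \<nu>"
  shows "\<mu> = \<nu>"
proof (rule measure_eqI)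
  let ?R = "restrict_space (torus_borel k) (V k)"
  have s [measurable_cong]: "sets \<mu> = sets ?R" "sets \<nu> = sets ?R"
    using \<mu> \<nu> by (auto simp: is_haar_V_def)
  then show "sets \<mu> = sets \<nu>" by simp
  interpret \<mu>: prob_space \<mu> using \<mu> by (simp add: is_haar_V_def)
  interpret \<nu>: prob_space \<nu> using \<nu> by (simp add: is_haar_V_def)
  interpret pair_sigma_finite \<mu> \<nu> ..
  have sp: "space \<mu> = V k" "space \<nu> = V k" by (rule is_haar_V_space, rule \<mu> \<nu>)+
  fix A assume A: "A \<in> sets \<mu>"
  then have A': "A \<in> sets ?R" "A \<in> sets \<nu>" using s by auto
  let ?f = "\<lambda>(v, w). indicator A (torus_add k v w) :: ennreal"
  have add: "(\<lambda>(v, w). torus_add k v w) \<in> measurable (\<mu> \<Otimes>\<^sub>M \<nu>) ?R"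
    using torus_add_measurable_V by (simp cong: measurable_cong_sets add: s cong: sets_pair_measure_cong)
  have f: "?f \<in> borel_measurable (\<mu> \<Otimes>\<^sub>M \<nu>)"
    unfolding split_beta using measurable_compose[OF add borel_measurable_indicator[OF A'(1)]] by (simp add: split_beta)
  have 1: "(\<integral>\<^sup>+w. ?f (v, w) \<partial>\<nu>) = emeasure \<nu> A" if "v \<in> V k" for v
  proof -
    have m: "torus_add k v -` A \<inter> V k \<in> sets \<nu>"
      using measurable_sets[OF measurable_compose[OF measurable_Pair1'[of v \<mu> \<nu>] add] A'(1)]
        that sp by simp
    have "(\<integral>\<^sup>+w. ?f (v, w) \<partial>\<nu>) = (\<integral>\<^sup>+w. indicator (torus_add k v -` A \<inter> V k) w \<partial>\<nu>)"
      by (intro nn_integral_cong) (auto simp: sp indicator_def)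
    also have "\<dots> = emeasure \<nu> A" using m is_haar_V_translate[OF \<nu> that A'(2)] by simp
    finally show ?thesis .
  qed
  have 2: "(\<integral>\<^sup>+v. ?f (v, w) \<partial>\<mu>) = emeasure \<mu> A" if "w \<in> V k" for w
  proof -
    have m: "torus_add k w -` A \<inter> V k \<in> sets \<mu>"
      using measurable_sets[OF measurable_compose[OF measurable_Pair2'[of w \<nu> \<mu>] add] A'(1)]
        that sp by (simp add: torus_add_commute[of k _ w])
    have "(\<integral>\<^sup>+v. ?f (v, w) \<partial>\<mu>) = (\<integral>\<^sup>+v. indicator (torus_add k w -` A \<inter> V k) v \<partial>\<mu>)"
      by (intro nn_integral_cong) (auto simp: sp indicator_def torus_add_commute[of k _ w])
    also have "\<dots> = emeasure \<mu> A" using m is_haar_V_translate[OF \<mu> that A] by simp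
    finally show ?thesis .
  qed
  have "emeasure \<mu> A = (\<integral>\<^sup>+w. emeasure \<mu> A \<partial>\<nu>)" by (simp add: \<nu>.emeasure_space_1)
  also have "\<dots> = (\<integral>\<^sup>+w. (\<integral>\<^sup>+v. ?f (v, w) \<partial>\<mu>) \<partial>\<nu>)"
    using 2 sp by (intro nn_integral_cong) auto
  also have "\<dots> = (\<integral>\<^sup>+v. (\<integral>\<^sup>+w. ?f (v, w) \<partial>\<nu>) \<partial>\<mu>)"
    by (rule Fubini[OF f])
  also have "\<dots> = (\<integral>\<^sup>+v. emeasure \<nu> A \<partial>\<mu>)"
    using 1 sp by (intro nn_integral_cong) auto
  also have "\<dots> = emeasure \<nu> A" by (simp add: \<mu>.emeasure_space_1)
  finally show "emeasure \<mu> A = emeasure \<nu> A" .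
qed

definition V_param :: "nat \<Rightarrow> (nat \<Rightarrow> circle) \<Rightarrow> torus_point"
  where "V_param k p =
    (\<lambda>i\<in>{1..k}. p 0 + int_scale (int (i - 1)) (p 1),
     \<lambda>i\<in>{1..k}. if i = 1 then \<Sum>j=2..k. int_scale ((-1) ^ j * int ((k - 1) choose (j - 1))) (p j) else p i)"

lemma V_sum_eq:
  assumes "k \<ge> 1"
  shows "(\<Sum>i=1..k. int_scale ((-1) ^ i * int ((k - 1) choose (i - 1))) (y i)) =
    (\<Sum>j=2..k. int_scale ((-1) ^ j * int ((k - 1) choose (j - 1))) (y j)) - y 1"
  using assms by (subst sum.atLeast_Suc_atMost) (simp_all add: numeral_2_eq_2)

lemma V_param_in_V:
  assumes "k \<ge> 1"
  shows "V_param k p \<in> V k"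
proof -
  have "\<forall>i\<in>{1..<k}. (p 0 + int_scale (int i) (p 1)) - (p 0 + int_scale (int (i - 1)) (p 1)) = p 1"
  proof
    fix i assume "i \<in> {1..<k}"
    then obtain j where "i = Suc j" by (cases i) auto
    then show "(p 0 + int_scale (int i) (p 1)) - (p 0 + int_scale (int (i - 1)) (p 1)) = p 1"
      by (simp add: circle.scale_left_distrib)
  qed
  then show ?thesis
    unfolding V_def V_param_def mem_Collect_eq case_prod_conv V_sum_eq[OF assms]
    using assms by (intro conjI exI[of _ "p 1"]) (simp_all del: of_nat_diff)
qed

lemma V_param_surj:
  assumes "k \<ge> 1" and v: "v \<in> V k"
  shows "\<exists>q. V_param k q = v"
proof -
  obtain x y d where v_eq: "v = (x, y)" and x: "x \<in> {1..k} \<rightarrow>\<^sub>E UNIV" and y: "y \<in> {1..k} \<rightarrow>\<^sub>E UNIV"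
    and d: "\<And>i. i \<in> {1..<k} \<Longrightarrow> x (i + 1) - x i = d"
    and s: "(\<Sum>i=1..k. int_scale ((-1) ^ i * int ((k - 1) choose (i - 1))) (y i)) = 0"
    using v by (auto simp: V_def)
  define q where "q i = (if i = 0 then x 1 else if i = 1 then d else y i)" for i :: nat
  have xi: "x (Suc i) = x 1 + int_scale (int i) d" if "Suc i \<le> k" for i
    using that
  proof (induction i)
    case (Suc i)
    then have "x (Suc (Suc i)) = x (Suc i) + d" using d[of "Suc i"] by (simp add: diff_eq_eq add.commute)
    with Suc show ?case by (simp add: circle.scale_left_distrib algebra_simps)
  qed simp
  have "fst (V_param k q) i = x i" for i
  proof (cases "i \<in> {1..k}")
    case True
    then show ?thesis using xi[of "i - 1"] by (simp add: V_param_def q_def del: of_nat_diff)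
  next
    case False
    then show ?thesis using x by (auto simp: V_param_def PiE_iff extensional_def)
  qed
  moreover have "snd (V_param k q) i = y i" for i
  proof (cases "i \<in> {1..k}")
    case True
    have "(\<Sum>j=2..k. int_scale ((-1) ^ j * int ((k - 1) choose (j - 1))) (q j)) =
      (\<Sum>j=2..k. int_scale ((-1) ^ j * int ((k - 1) choose (j - 1))) (y j))"
      by (intro sum.cong) (auto simp: q_def)
    also have "\<dots> = y 1" using s unfolding V_sum_eq[OF assms(1)] by simp
    finally show ?thesis using True by (simp add: V_param_def q_def)
  next
    case False
    then show ?thesis using y by (auto simp: V_param_def PiE_iff extensional_def)
  qed
  ultimately have "V_param k q = v" by (simp add: v_eq prod_eq_iff fun_eq_iff)
  then show ?thesis by blast
qed

lemma V_param_add: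
  assumes "k \<ge> 1"
  shows "V_param k (\<lambda>i\<in>{0..k}. p i + q i) = torus_add k (V_param k p) (V_param k q)"
proof -
  let ?c = "\<lambda>j. (-1) ^ j * int ((k - 1) choose (j - 1))" and ?r = "\<lambda>i\<in>{0..k}. p i + q i"
  have "(\<Sum>j=2..k. int_scale (?c j) (?r j)) = (\<Sum>j=2..k. int_scale (?c j) (p j) + int_scale (?c j) (q j))"
    by (intro sum.cong) (auto simp: circle.scale_right_distrib)
  then have *: "(\<Sum>j=2..k. int_scale (?c j) (?r j)) =
      (\<Sum>j=2..k. int_scale (?c j) (p j)) + (\<Sum>j=2..k. int_scale (?c j) (q j))"
    by (simp only: sum.distrib)
  have "fst (V_param k ?r) i = fst (torus_add k (V_param k p) (V_param k q)) i" for i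
    using assms by (simp add: V_param_def torus_add_def circle.scale_right_distrib add_ac)
  moreover have "snd (V_param k ?r) i = snd (torus_add k (V_param k p) (V_param k q)) i" for i
    unfolding V_param_def * by (simp add: torus_add_def)
  ultimately show ?thesis by (simp add: prod_eq_iff fun_eq_iff)
qed

lemma is_haar_V_exists:
  assumes k: "k \<ge> 1"
  shows "is_haar_V k (distr (PiM {0..k} (\<lambda>_. circle_measure)) (restrict_space (torus_borel k) (V k)) (V_param k))"
    (is "is_haar_V k (distr ?N ?R ?\<phi>)")
proof -
  interpret N: prob_space ?N by (intro prob_space_PiM prob_space_circle_measure)
  have "?\<phi> \<in> measurable ?N (torus_borel k)"
    unfolding V_param_def torus_borel_def using k by measurable
  then have \<phi>: "?\<phi> \<in> measurable ?N ?R"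
    using V_param_in_V[OF k] by (intro measurable_restrict_space2) auto
  have "emeasure (distr ?N ?R ?\<phi>) (torus_add k v ` A) = emeasure (distr ?N ?R ?\<phi>) A"
    if v: "v \<in> V k" and A: "A \<in> sets ?R" for v A
  proof -
    have AV: "A \<subseteq> V k" using sets.sets_into_space[OF A] by (simp add: space_restrict_space)
    obtain q where q: "V_param k q = torus_neg k v"
      using V_param_surj[OF k torus_neg_V[OF v]] by auto
    have "torus_add k (torus_neg k v) \<in> measurable ?R ?R"
      using measurable_compose[OF measurable_Pair1'[of "torus_neg k v" ?R ?R] torus_add_measurable_V]
        torus_neg_V[OF v] V_subset[of k] by (auto simp: space_restrict_space)
    from measurable_sets[OF this A]
    have "torus_add k (torus_neg k v) -` A \<inter> V k \<in> sets ?R"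
      using V_subset[of k] by (simp add: space_restrict_space Int_absorb2)
    then have "emeasure (distr ?N ?R ?\<phi>) (torus_add k v ` A) =
        emeasure ?N (?\<phi> -` (torus_add k (torus_neg k v) -` A \<inter> V k) \<inter> space ?N)"
      unfolding image_torus_add[OF v AV] by (intro emeasure_distr \<phi>)
    also have "?\<phi> -` (torus_add k (torus_neg k v) -` A \<inter> V k) \<inter> space ?N =
        (\<lambda>p. \<lambda>i\<in>{0..k}. q i + p i) -` (?\<phi> -` A \<inter> space ?N) \<inter> ({0..k} \<rightarrow>\<^sub>E UNIV)"
      using V_param_in_V[OF k] by (auto simp: space_PiM V_param_add[OF k] q)
    also have "emeasure ?N \<dots> = emeasure ?N (?\<phi> -` A \<inter> space ?N)"
      by (intro emeasure_PiM_translate measurable_sets[OF \<phi> A]) simp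
    also have "\<dots> = emeasure (distr ?N ?R ?\<phi>) A"
      by (intro emeasure_distr[symmetric] \<phi> A)
    finally show ?thesis .
  qed
  then show ?thesis using N.prob_space_distr[OF \<phi>] by (auto simp: is_haar_V_def)
qed

lemma is_haar_V_haar_V:
  assumes "k \<ge> 1"
  shows "is_haar_V k (haar_V k)"
proof -
  have "\<exists>!\<mu>. is_haar_V k \<mu>"
    using is_haar_V_exists[OF assms] is_haar_V_unique by blast
  then show ?thesis unfolding haar_V_def by (rule theI')
qed

end

theory Submission
  imports Defs "HOL-Real_Asymp.Real_Asymp"
begin

text \<open>
  Write \<open>n = k - 1\<close>, which is even. The extremal function is the indicator of the strip
  \<open>y - \<beta>(x) \<in> [0, \<alpha>)\<close> modulo \<open>1\<close>, which has first marginal \<open>\<alpha>\<close> for every \<open>\<beta>\<close>. A pattern in the strip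
  gives \<open>\<Sum>(-1)\<^sup>i (n choose i) \<beta>(x\<^sub>i) \<approx> 0\<close>. The leading base-\<open>B\<close> digits of \<open>\<beta>(x)\<close> record in which of
  \<open>L\<close> cells each of the points \<open>x, Mx, \<dots>, M\<^bsup>D-1\<^esup>x\<close> lies. Uniqueness of digits forces the alternating
  binomial sum over each cell to vanish, and for large \<open>L\<close> this only happens if none of the \<open>D\<close>
  dilated progressions wraps around the circle. The rest of \<open>\<beta>(x)\<close> is a multiple of
  \<open>\<Sum>\<^sub>l exp(frac(M\<^bsup>l\<^esup>x))\<close>, whose alternating sum is \<open>\<Sum>\<^sub>l exp(u\<^sub>l) (1 - exp(d\<^sub>l))\<^bsup>n\<^esup>\<close>. As \<open>n\<close> is even, all terms
  are nonnegative (a Behrend-type convexity argument), so every \<open>d\<^sub>l \<equiv> M\<^bsup>l\<^esup>d\<close> is below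
  \<open>1/(2M)\<close> and hence \<open>d\<close> is below \<open>1/(2M\<^bsup>D\<^esup>)\<close>. Taking \<open>D\<close> of order \<open>log(1/\<alpha>)\<close> and \<open>M\<close> a small power of
  \<open>1/\<alpha>\<close> makes the density of such patterns at most \<open>\<alpha>\<^bsup>c log(1/\<alpha>)\<^esup>\<close>.
\<close>

section \<open>Progressions that do not wrap around the circle\<close>

lemma alternating_binomial_power:
  fixes z :: "'a::comm_ring_1"
  shows "(\<Sum>i\<le>n. (-1) ^ i * of_nat (n choose i) * z ^ i) = (1 - z) ^ n"
proof -
  have "(1 - z) ^ n = (- z + 1) ^ n" by simp
  also have "\<dots> = (\<Sum>i\<le>n. of_nat (n choose i) * (- z) ^ i * 1 ^ (n - i))"
    by (rule binomial_ring)
  also have "\<dots> = (\<Sum>i\<le>n. (-1) ^ i * of_nat (n choose i) * z ^ i)"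
    by (intro sum.cong refl) (simp add: power_minus[of z] mult_ac)
  finally show ?thesis ..
qed

text \<open>Pascal's rule makes the sum telescope. Its use is that no proper initial segment
  (\<open>m < n\<close>) sums to \<open>0\<close>, which detects where a progression wraps.\<close>

lemma alternating_binomial_partial_sum:
  assumes "n \<ge> 1"
  shows "(\<Sum>i<Suc m. (-1) ^ i * int (n choose i)) = (-1) ^ m * int ((n - 1) choose m)"
proof (induction m)
  case (Suc m)
  obtain n' where n: "n = Suc n'" using assms by (cases n) auto
  show ?case using Suc by (simp add: n algebra_simps)
qed simp

lemma sum_abs_alternating_binomial:
  "(\<Sum>i\<le>n. \<bar>(-1) ^ i * real (n choose i)\<bar>) = 2 ^ n"
proof -
  have "(\<Sum>i\<le>n. \<bar>(-1) ^ i * real (n choose i)\<bar>) = real (\<Sum>i\<le>n. n choose i)"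
    by (simp add: abs_mult power_abs)
  then show ?thesis by (simp add: choose_row_sum)
qed

lemma alternating_binomial_bound:
  assumes "\<And>i. i \<le> n \<Longrightarrow> \<bar>f i\<bar> \<le> (e :: real)"
  shows "\<bar>\<Sum>i\<le>n. (-1) ^ i * real (n choose i) * f i\<bar> \<le> 2 ^ n * e"
proof -
  have "\<bar>\<Sum>i\<le>n. (-1) ^ i * real (n choose i) * f i\<bar> \<le> (\<Sum>i\<le>n. \<bar>(-1) ^ i * real (n choose i)\<bar> * e)"
    by (rule order.trans[OF sum_abs]) (auto intro!: sum_mono mult_left_mono assms simp: abs_mult)
  also have "\<dots> = 2 ^ n * e" by (simp only: sum_abs_alternating_binomial flip: sum_distrib_right)
  finally show ?thesis .
qed

lemma base_expansion_zero:
  fixes B :: int and S :: "nat \<Rightarrow> int"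
  assumes "(\<Sum>r<R. S r * B ^ r) = 0" and "\<And>r. r < R \<Longrightarrow> \<bar>S r\<bar> < B" and "r < R"
  shows "S r = 0"
  using assms
proof (induction R arbitrary: S r)
  case (Suc R)
  have eq: "(\<Sum>r<Suc R. S r * B ^ r) = S 0 + B * (\<Sum>r<R. S (Suc r) * B ^ r)"
    by (subst sum.lessThan_Suc_shift) (simp add: sum_distrib_left algebra_simps)
  have "B > 0" using Suc.prems(2)[of 0] by linarith
  have S0: "S 0 = 0"
  proof -
    have "S 0 = B * (- (\<Sum>r<R. S (Suc r) * B ^ r))" using eq Suc.prems(1) by simp
    then have "B dvd S 0" by (rule dvdI)
    then show ?thesis using Suc.prems(2)[of 0] dvd_imp_le_int[of "S 0" B] by force
  qed
  then have "(\<Sum>r<R. S (Suc r) * B ^ r) = 0" using eq Suc.prems(1) \<open>B > 0\<close> by simp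
  then have "S (Suc q) = 0" if "q < R" for q
    using Suc.IH[of "\<lambda>r. S (Suc r)"] Suc.prems(2) that by auto
  then show ?case using S0 Suc.prems(3) by (cases r) auto
qed simp

section \<open>Cells of the circle and characters along a progression\<close>

definition cell :: "nat \<Rightarrow> real \<Rightarrow> nat"
  where "cell L s = nat \<lfloor>real L * frac s\<rfloor>"

lemma cell_less: "L > 0 \<Longrightarrow> cell L s < L"
  using frac_lt_1[of s] frac_ge_0[of s]
  by (auto simp: cell_def nat_less_iff floor_less_iff)

lemma cell_bounds: "real (cell L s) \<le> real L * frac s" "real L * frac s < real (cell L s) + 1"
  using frac_ge_0[of s] by (simp_all add: cell_def)

text \<open>A weight depending only on the cell is a linear combination of cell indicators, so
  interchanging the two sums reduces to single cells.\<close>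

lemma sum_over_cells:
  fixes \<phi> :: "nat \<Rightarrow> 'a::comm_ring_1"
  assumes "L > 0" "\<And>a. a < L \<Longrightarrow> (\<Sum>i\<le>n. (-1) ^ i * int (n choose i) * of_bool (cell L (u i) = a)) = 0"
  shows "(\<Sum>i\<le>n. (-1) ^ i * of_nat (n choose i) * \<phi> (cell L (u i))) = 0"
proof -
  have "(\<Sum>i\<le>n. (-1) ^ i * of_nat (n choose i) * \<phi> (cell L (u i))) =
    (\<Sum>i\<le>n. \<Sum>a<L. (-1) ^ i * of_nat (n choose i) * (of_bool (cell L (u i) = a) * \<phi> a))"
    using cell_less[OF assms(1)] by (simp flip: sum_distrib_left)
  also have "\<dots> = (\<Sum>a<L. of_int (\<Sum>i\<le>n. (-1) ^ i * int (n choose i) * of_bool (cell L (u i) = a)) * \<phi> a)"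
    by (subst sum.swap) (simp add: sum_distrib_right mult.assoc)
  also have "\<dots> = 0" using assms(2) by (intro sum.neutral) (simp del: of_int_sum)
  finally show ?thesis .
qed


lemma norm_cis_diff: "norm (cis x - cis y) = 2 * \<bar>sin ((x - y) / 2)\<bar>"
proof -
  have "norm (cis x - cis y) = norm (cis y * (cis (x - y) - 1))"
    by (simp add: algebra_simps cis_mult)
  also have "\<dots> = norm (exp (\<i> * complex_of_real (x - y)) - 1)"
    by (simp add: norm_mult cis_conv_exp del: of_real_diff)
  also have "\<dots> = 2 * \<bar>sin ((x - y) / 2)\<bar>" by (rule dist_exp_i_1)
  finally show ?thesis .
qed

lemma norm_cis_diff_le: "norm (cis x - cis y) \<le> \<bar>x - y\<bar>"
  using abs_sin_x_le_abs_x[of "(x - y) / 2"] by (simp add: norm_cis_diff)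

lemma cis_frac: "cis (2 * pi * frac x) = cis (2 * pi * x)"
proof -
  have "cis (2 * pi * x) = cis (2 * pi * frac x + 2 * pi * of_int \<lfloor>x\<rfloor>)"
    by (simp add: frac_def algebra_simps)
  also have "\<dots> = cis (2 * pi * frac x) * cis (2 * pi * of_int \<lfloor>x\<rfloor>)" by (rule cis_mult[symmetric])
  also have "cis (2 * pi * of_int \<lfloor>x\<rfloor>) = 1" by (intro cis_multiple_2pi) simp
  finally show ?thesis by simp
qed

definition cells_vanish :: "nat \<Rightarrow> nat \<Rightarrow> (nat \<Rightarrow> real) \<Rightarrow> bool"
  where "cells_vanish n L u \<longleftrightarrow>
    (\<forall>a<L. (\<Sum>i\<le>n. (-1) ^ i * int (n choose i) * of_bool (cell L (u i) = a)) = 0)"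

text \<open>
  If the cell sums vanish, so does the sum weighted by any function of the cell; the character
  \<open>cis (2 * pi * x)\<close> is such a function up to an error of order \<open>1 / L\<close>.
\<close>

lemma cells_vanish_character:
  assumes "L > 0" "cells_vanish n L (\<lambda>i. t + real i * d)"
  shows "(2 * \<bar>sin (pi * d)\<bar>) ^ n \<le> 2 ^ n * (2 * pi / real L)"
proof -
  let ?c = "\<lambda>i. (-1) ^ i * of_nat (n choose i) :: complex"
  define a where "a i = cell L (t + real i * d)" for i
  \<comment> \<open>By the binomial theorem the character sums to a power of
    \<open>1 - cis (2 * pi * d)\<close>, which is small only for \<open>d\<close> near an
    integer.\<close>
  have "cis (2 * pi * t) * (1 - cis (2 * pi * d)) ^ n =
      (\<Sum>i\<le>n. ?c i * cis (2 * pi * (t + real i * d)))"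
    unfolding alternating_binomial_power[symmetric] sum_distrib_left
    by (intro sum.cong refl) (simp add: Complex.DeMoivre cis_mult algebra_simps)
  also have "\<dots> = (\<Sum>i\<le>n. ?c i * (cis (2 * pi * frac (t + real i * d)) - cis (2 * pi * (real (a i) / real L))))"
  proof -
    have "(\<Sum>i\<le>n. ?c i * cis (2 * pi * (real (a i) / real L))) = 0"
      unfolding a_def using assms
      by (intro sum_over_cells[of L n "\<lambda>i. t + real i * d" "\<lambda>a. cis (2 * pi * (real a / real L))"])
         (auto simp: cells_vanish_def)
    then show ?thesis by (simp only: cis_frac right_diff_distrib sum_subtractf) simp
  qed
  finally have eq: "cis (2 * pi * t) * (1 - cis (2 * pi * d)) ^ n = \<dots>" .
  have "norm (1 - cis (2 * pi * d)) ^ n = norm (cis (2 * pi * t) * (1 - cis (2 * pi * d)) ^ n)"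
    by (simp add: norm_mult norm_power)
  also have "\<dots> \<le> (\<Sum>i\<le>n. \<bar>(-1) ^ i * real (n choose i)\<bar> * (2 * pi / real L))"
    unfolding eq
  proof (rule sum_norm_le)
    fix i
    have "\<bar>x - y / L'\<bar> \<le> 1 / L'" if "y \<le> L' * x" "L' * x < y + 1" "L' > 0" for x y L' :: real
    proof -
      have "x - y / L' = (L' * x - y) / L'" using that by (simp add: field_simps)
      then show ?thesis using that by (simp add: divide_right_mono)
    qed
    then have "\<bar>frac (t + real i * d) - real (a i) / real L\<bar> \<le> 1 / real L"
      using cell_bounds[of L "t + real i * d"] assms(1) unfolding a_def by simp
    then have "\<bar>2 * pi * frac (t + real i * d) - 2 * pi * (real (a i) / real L)\<bar> \<le> 2 * pi / real L"
      unfolding right_diff_distrib[symmetric] abs_mult using pi_gt_zero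
      by (simp add: divide_inverse)
    then have "norm (cis (2 * pi * frac (t + real i * d)) - cis (2 * pi * (real (a i) / real L))) \<le> 2 * pi / real L"
      by (rule order.trans[OF norm_cis_diff_le])
    then show "norm (?c i * (cis (2 * pi * frac (t + real i * d)) - cis (2 * pi * (real (a i) / real L)))) \<le>
        \<bar>(-1) ^ i * real (n choose i)\<bar> * (2 * pi / real L)"
      by (simp add: norm_mult norm_power abs_mult power_abs mult_left_mono del: times_divide_eq_right times_divide_eq_left)
  qed
  also have "\<dots> = 2 ^ n * (2 * pi / real L)"
    by (simp only: sum_abs_alternating_binomial flip: sum_distrib_right)
  also have "norm (1 - cis (2 * pi * d)) = 2 * \<bar>sin (pi * d)\<bar>"
    using norm_cis_diff[of 0 "2 * pi * d"] by simp
  finally show ?thesis .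
qed

lemma first_failure:
  fixes P :: "nat \<Rightarrow> bool"
  assumes "P 0" "\<not> P j" "j \<le> n"
  obtains m where "Suc m \<le> n" "\<And>i. i \<le> m \<Longrightarrow> P i" "\<not> P (Suc m)"
proof -
  define i where "i = (LEAST i. \<not> P i)"
  have 1: "\<not> P i" unfolding i_def by (rule LeastI[of _ j]) (rule assms(2))
  have 2: "i \<le> j" unfolding i_def by (rule Least_le) (rule assms(2))
  have 3: "P l" if "l < i" for l using not_less_Least[of l "\<lambda>i. \<not> P i"] that unfolding i_def by blast
  obtain m where m: "i = Suc m" using assms(1) 1 by (cases i) auto
  show thesis
  proof (rule that[of m])
    show "Suc m \<le> n" using 2 m assms(3) by simp
    show "P l" if "l \<le> m" for l using 3 m that by simp
    show "\<not> P (Suc m)" using 1 m by simp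
  qed
qed

text \<open>With an even number of cells the half circle \<open>[1/2, 1)\<close> is a union of
  cells, so its indicator is an admissible weight.\<close>

lemma upper_half_cells:
  assumes "L > 0" "cells_vanish n (2 * L) u"
  shows "(\<Sum>i\<le>n. (-1) ^ i * int (n choose i) * of_bool (frac (u i) \<ge> 1 / 2)) = 0"
proof -
  have "L \<le> cell (2 * L) s \<longleftrightarrow> frac s \<ge> 1 / 2" for s
    using assms(1) by (simp add: cell_def le_nat_iff le_floor_iff field_simps)
  then show ?thesis
    using sum_over_cells[of "2 * L" n u "\<lambda>a. of_bool (L \<le> a) :: int"] assms
    by (simp add: cells_vanish_def)
qed

text \<open>
  A short progression that crosses \<open>0\<close> has its initial and its final segment in different halves
  of the circle, so that a proper partial sum of the alternating binomial coefficients would vanish.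
\<close>

lemma no_wrap_if_small:
  assumes n: "n \<ge> 1" and d: "\<bar>d\<bar> * (2 * real n) < 1" and L: "L > 0"
    and van: "cells_vanish n (2 * L) (\<lambda>i. t + real i * d)" and i: "i \<le> n"
  shows "frac (t + real i * d) = frac t + real i * d"
proof (rule ccontr)
  \<comment> \<open>\<open>v\<close> is the lift starting in \<open>[0, 1)\<close>; wrapping means
    that \<open>v\<close> leaves this interval, and \<open>Suc m\<close> below is the first index
    where it does.\<close>
  define v where "v i = frac t + real i * d" for i
  have fr: "frac (t + real i * d) = frac (v i)" for i by (simp add: v_def)
  have half: "\<bar>real i * d - real j * d\<bar> < 1 / 2" if "i \<le> n" "j \<le> n" for i j
  proof -
    have "\<bar>real i - real j\<bar> * \<bar>d\<bar> \<le> real n * \<bar>d\<bar>" using that by (intro mult_right_mono) auto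
    also have "\<dots> < 1 / 2" using d by (simp add: algebra_simps)
    finally show ?thesis by (simp add: abs_mult flip: left_diff_distrib)
  qed
  have v0: "0 \<le> v 0" "v 0 < 1" by (simp_all add: v_def frac_lt_1)
  assume neq: "frac (t + real i * d) \<noteq> frac t + real i * d"
  have "\<not> (0 \<le> v i \<and> v i < 1)"
  proof
    assume "0 \<le> v i \<and> v i < 1"
    then have "frac (v i) = v i" by (simp add: frac_eq)
    with fr[of i] have "frac (t + real i * d) = v i" by (rule trans)
    then show False using neq by (simp only: v_def)
  qed
  then obtain m where m: "Suc m \<le> n" "\<And>i. i \<le> m \<Longrightarrow> 0 \<le> v i \<and> v i < 1" "\<not> (0 \<le> v (Suc m) \<and> v (Suc m) < 1)"
    using first_failure[of "\<lambda>i. 0 \<le> v i \<and> v i < 1" i n] i v0 by metis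
  have diff: "v i < v j + 1 / 2" if "i \<le> n" "j \<le> n" for i j
    using half[OF that] unfolding v_def by linarith
  let ?c = "\<lambda>i. (-1) ^ i * int (n choose i)"
  have sum0: "(\<Sum>i\<le>n. ?c i * of_bool (frac (v i) \<ge> 1 / 2)) = 0"
    using upper_half_cells[OF L van] by (simp only: fr)
  \<comment> \<open>Up to sign this is \<open>(n - 1) choose m\<close> with
    \<open>m \<le> n - 1\<close>.\<close>
  have part: "(\<Sum>i\<le>m. ?c i) \<noteq> 0"
    using alternating_binomial_partial_sum[OF n, of m] m(1) by (simp add: lessThan_Suc_atMost)
  have full: "(\<Sum>i\<le>n. ?c i) = 0"
    using alternating_binomial_power[of n "1 :: int"] n by simp
  have split: "{..n} = {..m} \<union> {Suc m..n}" "{..m} \<inter> {Suc m..n} = {}" using m(1) by auto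
  show False
  proof (cases "v (Suc m) \<ge> 1")
    \<comment> \<open>Exit at \<open>1\<close>: as all points are within \<open>1 / 2\<close> of
      each other, those up to \<open>m\<close> lie in the upper half and the later ones land in the
      lower half.\<close>
    case True
    then have "d > 0" using m(2)[of m] by (auto simp: v_def algebra_simps)
    have "of_bool (frac (v i) \<ge> 1 / 2) = (of_bool (i \<le> m) :: int)" if "i \<le> n" for i
    proof (cases "i \<le> m")
      case True
      then have "frac (v i) = v i" using m(2) by (simp add: frac_eq)
      moreover have "v i > 1 / 2" using diff[of "Suc m" i] \<open>v (Suc m) \<ge> 1\<close> that m(1) by linarith
      ultimately show ?thesis using True by simp
    next
      case False
      then have "real (Suc m) * d \<le> real i * d" using \<open>d > 0\<close> by (intro mult_right_mono) auto
      then have "v i \<ge> 1" using True by (simp add: v_def)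
      moreover have "v i < 3 / 2" using diff[of i 0] that v0 by linarith
      ultimately have "frac (v i) = v i - 1" by (simp add: frac_unique_iff)
      then show ?thesis using False \<open>v i < 3 / 2\<close> by simp
    qed
    then have "(\<Sum>i\<le>n. ?c i * of_bool (frac (v i) \<ge> 1 / 2)) = (\<Sum>i\<le>n. ?c i * of_bool (i \<le> m))"
      by (intro sum.cong) auto
    also have "\<dots> = (\<Sum>i\<le>m. ?c i)" unfolding split(1) by (subst sum.union_disjoint) auto
    finally show False using sum0 part by simp
  next
    \<comment> \<open>Exit at \<open>0\<close>: now the points after \<open>m\<close> lie in the
      upper half, and their sum is the full sum \<open>0\<close> minus the same partial sum.\<close>
    case False
    then have neg: "v (Suc m) < 0" using m(3) by simp
    then have "d < 0" using m(2)[of m] by (auto simp: v_def algebra_simps)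
    have "of_bool (frac (v i) \<ge> 1 / 2) = (1 - of_bool (i \<le> m) :: int)" if "i \<le> n" for i
    proof (cases "i \<le> m")
      case True
      then have "frac (v i) = v i" using m(2) by (simp add: frac_eq)
      moreover have "v i < 1 / 2" using diff[of i "Suc m"] neg that m(1) by linarith
      ultimately show ?thesis using True by simp
    next
      case False
      then have "real i * d \<le> real (Suc m) * d" using \<open>d < 0\<close> by (intro mult_right_mono_neg) auto
      then have "v i < 0" using neg by (simp add: v_def)
      moreover have "v i > - 1 / 2" using diff[of 0 i] that v0 by linarith
      ultimately have "frac (v i) = v i + 1" by (simp add: frac_unique_iff)
      then show ?thesis using False \<open>v i > - 1 / 2\<close> by simp
    qed
    then have "(\<Sum>i\<le>n. ?c i * of_bool (frac (v i) \<ge> 1 / 2)) = (\<Sum>i\<le>n. ?c i * (1 - of_bool (i \<le> m)))"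
      by (intro sum.cong) auto
    also have "\<dots> = (\<Sum>i\<le>n. ?c i) - (\<Sum>i\<le>n. ?c i * of_bool (i \<le> m))"
      by (simp add: right_diff_distrib sum_subtractf)
    also have "(\<Sum>i\<le>n. ?c i * of_bool (i \<le> m)) = (\<Sum>i\<le>m. ?c i)"
      unfolding split(1) by (subst sum.union_disjoint) auto
    finally show False using sum0 part full by simp
  qed
qed

text \<open>Differences below \<open>1 / (2 * n)\<close> are covered by
  \<open>no_wrap_if_small\<close>; larger ones would make the character sum exceed its error of
  order \<open>1 / L\<close> once \<open>L\<close> is large. The choice depends on \<open>n\<close>
  only, so one \<open>L\<close> serves all dilates.\<close>

lemma exists_no_wrap_cells:
  assumes n: "n \<ge> 1"
  shows "\<exists>L>0. \<forall>t d. \<bar>d\<bar> \<le> 1 / 2 \<and> cells_vanish n L (\<lambda>i. t + real i * d) \<longrightarrow>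
    (\<forall>i\<le>n. frac (t + real i * d) = frac t + real i * d)"
proof -
  define \<delta> where "\<delta> = 1 / (2 * real n)"
  have \<delta>: "0 < \<delta>" "\<delta> \<le> 1 / 2" using n by (auto simp: \<delta>_def field_simps)
  have "sin (pi * \<delta>) > 0" using \<delta> by (intro sin_gt_zero) (auto simp: field_simps)
  then have pos: "(2 * sin (pi * \<delta>)) ^ n > 0" by simp
  obtain L where L: "2 ^ n * (2 * pi) / (2 * sin (pi * \<delta>)) ^ n < real L"
    using reals_Archimedean2 by blast
  have "L > 0"
  proof (rule ccontr)
    assume "\<not> L > 0"
    then have "2 ^ n * (2 * pi) / (2 * sin (pi * \<delta>)) ^ n < 0" using L by simp
    moreover have "2 ^ n * (2 * pi) / (2 * sin (pi * \<delta>)) ^ n > 0"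
      using pos by (intro divide_pos_pos) auto
    ultimately show False by linarith
  qed
  have "frac (t + real i * d) = frac t + real i * d"
    if d: "\<bar>d\<bar> \<le> 1 / 2" and van: "cells_vanish n (2 * L) (\<lambda>i. t + real i * d)" and i: "i \<le> n" for t d i
  proof -
    have "\<bar>d\<bar> < \<delta>"
    proof (rule ccontr)
      assume "\<not> \<bar>d\<bar> < \<delta>"
      then have "sin (pi * \<delta>) \<le> sin (pi * \<bar>d\<bar>)"
        using d \<delta> \<open>\<not> \<bar>d\<bar> < \<delta>\<close> pi_gt_zero
        by (intro sin_monotone_2pi_le) (auto simp: field_simps intro: order.trans[of _ 0])
      also have "\<dots> \<le> \<bar>sin (pi * d)\<bar>" by (cases "d \<ge> 0") auto
      finally have "(2 * sin (pi * \<delta>)) ^ n \<le> (2 * \<bar>sin (pi * d)\<bar>) ^ n"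
        using \<open>sin (pi * \<delta>) > 0\<close> by (intro power_mono) auto
      also have "\<dots> \<le> 2 ^ n * (2 * pi / real (2 * L))"
        using \<open>L > 0\<close> van by (intro cells_vanish_character) auto
      finally have "(2 * sin (pi * \<delta>)) ^ n \<le> 2 ^ n * (2 * pi / real (2 * L))" .
      moreover have "2 ^ n * (2 * pi / real (2 * L)) < 2 ^ n * (2 * pi) / real L" using \<open>L > 0\<close> by (simp add: field_simps)
      moreover have "2 ^ n * (2 * pi) / real L < (2 * sin (pi * \<delta>)) ^ n" using L pos \<open>L > 0\<close>
        unfolding pos_divide_less_eq[OF pos] by (simp add: pos_divide_less_eq mult.commute)
      ultimately show False by linarith
    qed
    then have "\<bar>d\<bar> * (2 * real n) < 1" using n by (simp add: \<delta>_def field_simps)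
    then show ?thesis using no_wrap_if_small[OF n _ \<open>L > 0\<close> van i] by simp
  qed
  \<comment> \<open>The number of cells is doubled to make it even, as
    \<open>upper_half_cells\<close> requires.\<close>
  then show ?thesis using \<open>L > 0\<close> by (intro exI[of _ "2 * L"]) auto
qed

section \<open>Lower bound for alternating sums of the exponential\<close>

lemma exp_minus_one_bound:
  assumes "\<bar>d\<bar> \<le> 1 / 2"
  shows "\<bar>d\<bar> / 2 \<le> \<bar>1 - exp (d :: real)\<bar>"
proof (cases "d \<ge> 0")
  case True
  then show ?thesis using exp_ge_add_one_self[of d] by linarith
next
  case False
  \<comment> \<open>For \<open>d < 0\<close> the chain is
    \<open>exp d \<le> 1 / (1 - d) \<le> 1 + d / 2\<close>, with denominators cleared.\<close>
  have "exp d * (1 - d) \<le> exp d * exp (- d)"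
    using exp_ge_add_one_self[of "- d"] by (intro mult_left_mono) auto
  then have *: "exp d * (1 - d) \<le> 1" by (simp flip: exp_add)
  have "exp d * (1 - d) \<le> (1 + d / 2) * (1 - d)"
  proof -
    have "0 \<le> - d * (1 + d)" using False assms by (intro mult_nonneg_nonneg) auto
    then have "1 \<le> (1 + d / 2) * (1 - d)" by (simp add: field_simps)
    with * show ?thesis by linarith
  qed
  then have "exp d \<le> 1 + d / 2" using False by (simp add: mult_le_cancel_right)
  then show ?thesis using False by simp
qed

text \<open>The sum factors as \<open>exp t * (1 - exp d) ^ n\<close>. For even \<open>n\<close>
  this is nonnegative, so contributions of different dilates cannot cancel, and
  \<open>t \<ge> 0\<close> lets the factor \<open>exp t\<close> be dropped.\<close>

lemma alternating_exp_lower_bound: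
  assumes "even n" "\<bar>d\<bar> \<le> 1 / 2" "t \<ge> 0"
  shows "(\<bar>d\<bar> / 2) ^ n \<le> (\<Sum>i\<le>n. (-1) ^ i * real (n choose i) * exp (t + real i * d))"
proof -
  have "(\<bar>d\<bar> / 2) ^ n \<le> \<bar>1 - exp d\<bar> ^ n" using exp_minus_one_bound[OF assms(2)] by (intro power_mono) auto
  also have "\<dots> = (1 - exp d) ^ n" using assms(1) by (rule power_even_abs)
  also have "\<dots> \<le> exp t * (1 - exp d) ^ n"
    using assms(1,3) zero_le_even_power[of n "1 - exp d"] by (intro mult_le_cancel_right1[THEN iffD2]) auto
  also have "\<dots> = (\<Sum>i\<le>n. (-1) ^ i * real (n choose i) * exp (t + real i * d))"
    unfolding alternating_binomial_power[symmetric] sum_distrib_left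
    by (intro sum.cong refl) (simp add: exp_add exp_of_nat_mult)
  finally show ?thesis .
qed

section \<open>Encoding the dilates of a point\<close>

text \<open>The digit at position \<open>l * L + a\<close> is \<open>1\<close> iff the \<open>l\<close>-th dilate of the point lies in cell \<open>a\<close>.\<close>

definition code :: "nat \<Rightarrow> nat \<Rightarrow> nat \<Rightarrow> nat \<Rightarrow> real \<Rightarrow> nat"
  where "code n L M D s = (\<Sum>r<D * L. of_bool (cell L (real M ^ (r div L) * s) = r mod L) * (2 ^ (n + 3)) ^ r)"

definition weight :: "nat \<Rightarrow> nat \<Rightarrow> real \<Rightarrow> real"
  where "weight M D s = (\<Sum>l<D. exp (frac (real M ^ l * s)))"

text \<open>
  The scaling of the weight and the extra factor of the base in the denominator keep all
  alternating sums of offsets below \<open>1 / 4\<close>, so that congruences modulo \<open>1\<close> become equalities.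
\<close>

definition offset :: "nat \<Rightarrow> nat \<Rightarrow> nat \<Rightarrow> nat \<Rightarrow> real \<Rightarrow> real"
  where "offset n L M D s =
    (real (code n L M D s) + weight M D s / (3 * real D * 2 ^ (n + 2))) / (2 ^ (n + 3)) ^ (D * L + 1)"

lemma sum_powers_le:
  assumes "B \<ge> (2 :: nat)"
  shows "(\<Sum>r<R. B ^ r) \<le> B ^ R"
proof (induction R)
  case (Suc R)
  then have "(\<Sum>r<Suc R. B ^ r) \<le> 2 * B ^ R" by simp
  also have "\<dots> \<le> B ^ Suc R" using assms by simp
  finally show ?case .
qed simp

lemma code_le: "code n L M D s \<le> (2 ^ (n + 3)) ^ (D * L)"
proof -
  have "code n L M D s \<le> (\<Sum>r<D * L. (2 ^ (n + 3)) ^ r)"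
    unfolding code_def by (intro sum_mono) auto
  also have "\<dots> \<le> (2 ^ (n + 3)) ^ (D * L)"
    using self_le_power[of "2 :: nat" "n + 3"] by (intro sum_powers_le) simp
  finally show ?thesis .
qed

lemma weight_nonneg: "0 \<le> weight M D s"
  by (simp add: weight_def sum_nonneg)

lemma weight_le: "weight M D s \<le> 3 * real D"
proof -
  have "exp (frac x) \<le> 3" for x :: real
    using exp_le frac_lt_1[of x] exp_le_cancel_iff[of "frac x" 1] by linarith
  then have "weight M D s \<le> (\<Sum>l<D. 3)" unfolding weight_def by (intro sum_mono) auto
  then show ?thesis by simp
qed

text \<open>\<open>3 * D\<close> bounds the weight because \<open>exp 1 \<le> 3\<close>; the factor
  \<open>2 ^ (n + 2)\<close> then keeps alternating sums of scaled weights within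
  \<open>1 / 4\<close>.\<close>

lemma scaled_weight_bounds:
  "0 \<le> weight M D s / (3 * real D * 2 ^ (n + 2))"
  "weight M D s / (3 * real D * 2 ^ (n + 2)) \<le> 1 / 2 ^ (n + 2)"
proof -
  show "0 \<le> weight M D s / (3 * real D * 2 ^ (n + 2))" using weight_nonneg by simp
  have "weight M D s / (3 * real D) \<le> 1"
    \<comment> \<open>For \<open>D = 0\<close> the quotient is \<open>0\<close> by the convention
      for division by zero.\<close>
    using weight_le[of M D s] by (cases "D = 0") (simp_all add: divide_le_eq)
  then have "weight M D s / (3 * real D) / 2 ^ (n + 2) \<le> 1 / 2 ^ (n + 2)"
    by (intro divide_right_mono) auto
  then show "weight M D s / (3 * real D * 2 ^ (n + 2)) \<le> 1 / 2 ^ (n + 2)" by simp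
qed

lemma offset_bounds: "0 \<le> offset n L M D s" "offset n L M D s \<le> 2 / 2 ^ (n + 3)"
proof -
  let ?B = "2 ^ (n + 3) :: real"
  show "0 \<le> offset n L M D s" 
    unfolding offset_def by (intro divide_nonneg_nonneg add_nonneg_nonneg scaled_weight_bounds) auto
  have "real (code n L M D s) \<le> ?B ^ (D * L)"
    using code_le[of n L M D s] by (simp flip: of_nat_le_iff[where ?'a = real])
  moreover have "1 / 2 ^ (n + 2) \<le> (1 :: real)"
    using one_le_power[of "2 :: real" "n + 2"] by (simp add: divide_le_eq del: power_add)
  moreover have "1 \<le> ?B ^ (D * L)" by (intro one_le_power) auto
  ultimately have "real (code n L M D s) + weight M D s / (3 * real D * 2 ^ (n + 2)) \<le> 2 * ?B ^ (D * L)"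
    using scaled_weight_bounds(2)[of M D s n] by linarith
  then have "offset n L M D s \<le> (2 * ?B ^ (D * L)) / ?B ^ (D * L + 1)"
    unfolding offset_def by (intro divide_right_mono) auto
  also have "\<dots> = 2 / ?B" by simp
  finally show "offset n L M D s \<le> 2 / 2 ^ (n + 3)" .
qed

section \<open>Congruences modulo 1 and what a pattern forces on its difference\<close>

lemma frac_eqI: "x - y \<in> \<int> \<Longrightarrow> frac x = frac (y :: real)"
  using frac_add_int_right[of "x - y" y] by simp

lemma frac_mult_of_nat_frac: "frac (real m * frac s) = frac (real m * s)"
  by (rule frac_eqI) (simp add: frac_def algebra_simps)

text \<open>Multiplication by the integer \<open>M ^ l\<close> respects congruence modulo
  \<open>1\<close>, so the offset may be evaluated at any real representative of a point of the
  circle.\<close>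

lemma offset_frac: "offset n L M D (frac s) = offset n L M D s"
proof -
  have "frac (real M ^ l * frac s) = frac (real M ^ l * s)" for l
    using frac_mult_of_nat_frac[of "M ^ l" s] by simp
  then show ?thesis by (simp add: offset_def code_def weight_def cell_def)
qed

lemma eq_if_half_bounded:
  assumes "x - y \<in> \<int>" "\<bar>x\<bar> \<le> 1 / 2" "\<bar>y\<bar> < 1 / 2"
  shows "x = (y :: real)"
  using Ints_nonzero_abs_less1[OF assms(1)] assms(2,3) by linarith

text \<open>Induction on \<open>l\<close>: once \<open>M ^ l * d\<close> itself is below
  \<open>1 / (2 * M)\<close>, the next dilate is at most \<open>1 / 2\<close> in absolute value and
  so equals its reduced form, whose smallness is assumed. The last dilate then bounds
  \<open>d\<close>.\<close>

lemma small_difference_if_dilates_small: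
  assumes M: "M \<ge> 1" and D: "D \<ge> 1" and d: "\<bar>d\<bar> \<le> 1 / 2"
    and small: "\<And>l. l < D \<Longrightarrow> \<bar>real M ^ l * d - of_int (round (real M ^ l * d))\<bar> < 1 / (2 * real M)"
  shows "\<bar>d\<bar> < 1 / (2 * real M ^ D)"
proof -
  have M2: "1 / (2 * real M) \<le> 1 / 2" using M by (simp add: divide_le_eq)
  have "\<bar>real M ^ l * d\<bar> < 1 / (2 * real M)" if "l < D" for l
    using that
  proof (induction l)
    case 0
    have "real M ^ 0 * d = real M ^ 0 * d - of_int (round (real M ^ 0 * d))"
      using small[OF 0] d M2 by (intro eq_if_half_bounded) auto
    then show ?case using small[OF 0] by simp
  next
    case (Suc l)
    have "\<bar>real M ^ Suc l * d\<bar> = real M * \<bar>real M ^ l * d\<bar>" by (simp add: abs_mult)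
    also have "\<dots> \<le> real M * (1 / (2 * real M))" using Suc by (intro mult_left_mono) auto
    also have "\<dots> = 1 / 2" using M by simp
    finally have "real M ^ Suc l * d = real M ^ Suc l * d - of_int (round (real M ^ Suc l * d))"
      using small[OF Suc.prems] M2 by (intro eq_if_half_bounded) auto
    then show ?case using small[OF Suc.prems] by simp
  qed
  then have "\<bar>real M ^ (D - 1) * d\<bar> < 1 / (2 * real M)" using D by simp
  then have "\<bar>d\<bar> * (real M ^ (D - 1) * M) < 1 / 2" using M by (simp add: abs_mult field_simps)
  also have "real M ^ (D - 1) * M = real M ^ D" using D by (metis power_minus_mult zero_less_one_class.zero_less_one less_le_trans)
  finally show ?thesis using M by (simp add: field_simps)
qed

text \<open>After scaling, the sum of offsets splits into an integer, whose signed digits are the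
  cell sums of the dilates, and a remainder from the weights.\<close>

lemma offset_expansion:
  fixes c :: "nat \<Rightarrow> int"
  shows "(\<Sum>i\<le>n. real_of_int (c i) * offset n L M D (u i)) * (2 ^ (n + 3)) ^ (D * L + 1) =
    real_of_int (\<Sum>r<D * L. (\<Sum>i\<le>n. c i * of_bool (cell L (real M ^ (r div L) * u i) = r mod L)) * (2 ^ (n + 3)) ^ r)
    + (\<Sum>i\<le>n. real_of_int (c i) * weight M D (u i)) / (3 * real D * 2 ^ (n + 2))"
proof -
  let ?W = "3 * real D * 2 ^ (n + 2)"
  have "(\<Sum>i\<le>n. real_of_int (c i) * offset n L M D (u i)) * (2 ^ (n + 3)) ^ (D * L + 1) =
    (\<Sum>i\<le>n. real_of_int (c i) * (real (code n L M D (u i)) + weight M D (u i) / ?W))"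
    unfolding sum_distrib_right by (intro sum.cong refl) (simp add: offset_def)
  also have "\<dots> = real_of_int (\<Sum>i\<le>n. c i * int (code n L M D (u i))) + (\<Sum>i\<le>n. real_of_int (c i) * weight M D (u i)) / ?W"
    by (simp add: distrib_left sum.distrib sum_divide_distrib)
  also have "(\<Sum>i\<le>n. c i * int (code n L M D (u i))) =
    (\<Sum>i\<le>n. \<Sum>r<D * L. c i * of_bool (cell L (real M ^ (r div L) * u i) = r mod L) * (2 ^ (n + 3)) ^ r)"
    by (simp add: code_def sum_distrib_left mult.assoc del: sum_of_bool_mult_eq sum_mult_of_bool_eq)
  also have "\<dots> = (\<Sum>r<D * L. (\<Sum>i\<le>n. c i * of_bool (cell L (real M ^ (r div L) * u i) = r mod L)) * (2 ^ (n + 3)) ^ r)"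
    by (subst sum.swap) (simp add: sum_distrib_right del: sum_of_bool_mult_eq sum_mult_of_bool_eq)
  finally show ?thesis .
qed

text \<open>\<open>\<theta> i\<close> is the position of a point inside the strip. The integer part
  and the weight part of the scaled sum are separated by size: the first excludes wrapping, and only
  then does the second become a sum of nonnegative terms.\<close>

lemma pattern_forces_small_difference:
  fixes \<theta> :: "nat \<Rightarrow> real" and n L M D :: nat and \<alpha> t d :: real
  defines "Bp \<equiv> (2 ^ (n + 3)) ^ (D * L + 1) :: real"
  assumes n: "n \<ge> 1" "even n" and L: "L > 0" and D: "D \<ge> 1" and M: "M \<ge> 1"
    and no_wrap: "\<And>t d i. \<bar>d\<bar> \<le> 1 / 2 \<Longrightarrow> cells_vanish n L (\<lambda>i. t + real i * d) \<Longrightarrow> i \<le> n \<Longrightarrow>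
      frac (t + real i * d) = frac t + real i * d"
    and \<theta>: "\<And>i. i \<le> n \<Longrightarrow> \<bar>\<theta> i\<bar> \<le> \<alpha>"
    and sum_Ints: "(\<Sum>i\<le>n. (-1) ^ i * real (n choose i) * (offset n L M D (t + real i * d) + \<theta> i)) \<in> \<int>"
    and small1: "2 ^ n * \<alpha> * Bp \<le> 1 / 4"
    and small2: "2 ^ n * \<alpha> * Bp * (3 * real D * 2 ^ (n + 2)) < (1 / (4 * real M)) ^ n"
    and d: "\<bar>d\<bar> \<le> 1 / 2"
  shows "\<bar>d\<bar> < 1 / (2 * real M ^ D)"
proof -
  define c where "c i = (-1) ^ i * int (n choose i)" for i
  have c: "real_of_int (c i) = (-1) ^ i * real (n choose i)" for i by (simp add: c_def)
  define u where "u i = t + real i * d" for i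
  define A where "A = (\<Sum>i\<le>n. real_of_int (c i) * offset n L M D (u i))"
  define T where "T = (\<Sum>i\<le>n. real_of_int (c i) * \<theta> i)"
  define S where "S r = (\<Sum>i\<le>n. c i * of_bool (cell L (real M ^ (r div L) * u i) = r mod L))" for r
  define N where "N = (\<Sum>r<D * L. S r * (2 ^ (n + 3)) ^ r)"
  define W where "W = (\<Sum>i\<le>n. real_of_int (c i) * weight M D (u i))"
  have Bp1: "1 \<le> Bp" unfolding Bp_def by (intro one_le_power) auto
  have \<alpha>0: "0 \<le> \<alpha>" using \<theta>[of 0] by simp
  have T: "\<bar>T\<bar> \<le> 2 ^ n * \<alpha>" unfolding T_def c by (intro alternating_binomial_bound \<theta>)
  have "2 ^ n * \<alpha> \<le> 2 ^ n * \<alpha> * Bp" 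
    using mult_left_mono[OF Bp1, of "2 ^ n * \<alpha>"] \<alpha>0 by simp
  with T small1 have T4: "\<bar>T\<bar> \<le> 1 / 4" by linarith
  have A4: "\<bar>A\<bar> \<le> 1 / 4"
  proof -
    have "\<bar>A\<bar> \<le> 2 ^ n * (2 / 2 ^ (n + 3))"
      unfolding A_def c using offset_bounds by (intro alternating_binomial_bound) (simp only: abs_of_nonneg)
    \<comment> \<open>This uses the \<open>3\<close> in the base \<open>2 ^ (n + 3)\<close>.\<close>
    also have "\<dots> = 1 / 4" by (simp add: power_add)
    finally show ?thesis .
  qed
  have "A + T \<in> \<int>"
    using sum_Ints by (simp add: A_def T_def c u_def distrib_left sum.distrib)
  \<comment> \<open>An integer of absolute value at most \<open>1 / 2\<close> is \<open>0\<close>: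
    the congruence becomes an equality.\<close>
  then have "A + T = 0" using Ints_nonzero_abs_less1[of "A + T"] A4 T4 by linarith
  then have A: "\<bar>A\<bar> \<le> 2 ^ n * \<alpha>" using T by linarith
  then have ABp: "\<bar>A * Bp\<bar> \<le> 2 ^ n * \<alpha> * Bp" using Bp1 by (simp add: abs_mult mult_right_mono)
  have exp: "A * Bp = real_of_int N + W / (3 * real D * 2 ^ (n + 2))"
    unfolding A_def Bp_def N_def S_def W_def by (rule offset_expansion)
  have "W / (3 * real D * 2 ^ (n + 2)) = (\<Sum>i\<le>n. real_of_int (c i) * (weight M D (u i) / (3 * real D * 2 ^ (n + 2))))"
    unfolding W_def by (simp add: sum_divide_distrib)
  also have "\<bar>\<dots>\<bar> \<le> 2 ^ n * (1 / 2 ^ (n + 2))"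
    unfolding c using scaled_weight_bounds by (intro alternating_binomial_bound) (simp only: abs_of_nonneg)
  also have "\<dots> = 1 / 4" by (simp add: power_add)
  finally have "\<bar>W / (3 * real D * 2 ^ (n + 2))\<bar> \<le> 1 / 4" .
  \<comment> \<open>The scaled error and the weight part contribute at most \<open>1 / 4\<close>
    each.\<close>
  then have "\<bar>real_of_int N\<bar> \<le> 1 / 2" using exp ABp small1 by linarith
  then have N: "N = 0" by linarith
  have "S r = 0" if "r < D * L" for r
  proof (rule base_expansion_zero[OF _ _ that])
    show "(\<Sum>r<D * L. S r * (2 ^ (n + 3)) ^ r) = 0" using N by (simp add: N_def)
    fix r
    have "\<bar>S r\<bar> \<le> (\<Sum>i\<le>n. int (n choose i))"
      unfolding S_def c_def by (rule order.trans[OF sum_abs]) (intro sum_mono, simp add: abs_mult power_abs)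
    also have "\<dots> = 2 ^ n" by (simp add: choose_row_sum flip: of_nat_sum)
    also have "\<dots> < 2 ^ (n + 3)" by (intro power_strict_increasing) auto
    finally show "\<bar>S r\<bar> < 2 ^ (n + 3)" .
  qed
  then have van: "cells_vanish n L (\<lambda>i. real M ^ l * u i)" if "l < D" for l
  proof -
    have "(\<Sum>i\<le>n. (-1) ^ i * int (n choose i) * of_bool (cell L (real M ^ l * u i) = a)) = 0" if "a < L" for a
    proof -
      have "l * L + a < (l + 1) * L" using that by simp
      also have "\<dots> \<le> D * L" using \<open>l < D\<close> by (intro mult_le_mono1) auto
      finally have "S (l * L + a) = 0" by (rule \<open>\<And>r. r < D * L \<Longrightarrow> S r = 0\<close>)
      then show ?thesis using that by (simp add: S_def c_def)
    qed
    then show ?thesis by (simp add: cells_vanish_def)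
  qed
  \<comment> \<open>The representative of \<open>M ^ l * d\<close> nearest to \<open>0\<close>;
    passing to it shifts the points of the dilated progression by integers only.\<close>
  define dl where "dl l = real M ^ l * d - of_int (round (real M ^ l * d))" for l
  have dl: "\<bar>dl l\<bar> \<le> 1 / 2" for l
    using of_int_round_abs_le[of "real M ^ l * d"] by (simp add: dl_def abs_minus_commute)
  have fr: "frac (real M ^ l * u i) = frac (real M ^ l * t + real i * dl l)" for l i
  proof (rule frac_eqI)
    have "real M ^ l * u i - (real M ^ l * t + real i * dl l) = of_int (int i * round (real M ^ l * d))"
      by (simp add: u_def dl_def algebra_simps)
    then show "real M ^ l * u i - (real M ^ l * t + real i * dl l) \<in> \<int>" by (simp only: Ints_of_int)
  qed
  have fr2: "frac (real M ^ l * u i) = frac (real M ^ l * t) + real i * dl l" if "l < D" "i \<le> n" for l i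
  proof -
    have "cells_vanish n L (\<lambda>i. real M ^ l * t + real i * dl l)"
      using van[OF that(1)] by (simp only: cells_vanish_def cell_def fr)
    from no_wrap[OF dl this that(2)] show ?thesis by (simp only: fr)
  qed
  have "\<bar>dl l\<bar> < 1 / (2 * real M)" if "l < D" for l
  proof -
    \<comment> \<open>A single nonnegative term is at most the total \<open>W\<close>, which is the
      scaled error since \<open>N = 0\<close>.\<close>
    have "(\<bar>dl l\<bar> / 2) ^ n \<le> (\<Sum>l<D. (\<bar>dl l\<bar> / 2) ^ n)"
      using that by (intro member_le_sum) auto
    also have "\<dots> \<le> (\<Sum>l<D. \<Sum>i\<le>n. (-1) ^ i * real (n choose i) * exp (frac (real M ^ l * t) + real i * dl l))"
      using n dl by (intro sum_mono alternating_exp_lower_bound) auto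
    also have "\<dots> = (\<Sum>l<D. \<Sum>i\<le>n. real_of_int (c i) * exp (frac (real M ^ l * u i)))"
      unfolding c by (intro sum.cong refl) (simp add: fr2)
    also have "\<dots> = W" unfolding W_def weight_def sum_distrib_left by (rule sum.swap)
    also have "W = (A * Bp) * (3 * real D * 2 ^ (n + 2))" using D by (simp add: exp N)
    also have "\<dots> \<le> (2 ^ n * \<alpha> * Bp) * (3 * real D * 2 ^ (n + 2))"
      using ABp by (intro mult_right_mono[of "A * Bp"]) auto
    also have "\<dots> < (1 / (4 * real M)) ^ n" by (rule small2)
    finally have "\<bar>dl l\<bar> / 2 < 1 / (4 * real M)" by (rule power_less_imp_less_base) simp
    then show ?thesis by simp
  qed
  then show ?thesis unfolding dl_def by (intro small_difference_if_dilates_small M D d)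
qed

section \<open>Strips in the torus\<close>

text \<open>Off a small open neighbourhood \<open>U\<close> of the frontier the indicator does not
  change over distances below a uniform \<open>d\<close>, so each tile of a \<open>d\<close>-fine
  division contributes an error at most the measure of its part in \<open>U\<close>.\<close>

lemma riemann_integrable_indicator:
  fixes A :: "'a::euclidean_space set"
  assumes neg: "negligible (frontier A)"
  shows "riemann_integrable_cbox (indicator A) a b"
proof -
  let ?f = "indicat_real A"
  have A_cbox: "A \<inter> cbox a b \<in> lmeasurable"
  proof -
    have "frontier (A \<inter> cbox a b) \<subseteq> frontier A \<union> frontier (cbox a b)" by (rule frontier_Int_subset)
    then have "negligible (frontier (A \<inter> cbox a b))"
      using neg negligible_convex_frontier[of "cbox a b"] by (meson convex_box(1) negligible_Un negligible_subset)
    then show ?thesis by (intro measurable_Jordan) (auto intro: bounded_subset[OF bounded_cbox])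
  qed
  then have int: "?f integrable_on cbox a b" by (simp add: integrable_on_indicator)
  have "\<exists>d>0. \<forall>D. D tagged_division_of cbox a b \<and> (\<lambda>x. ball x d) fine D \<longrightarrow>
       \<bar>(\<Sum>(x, K)\<in>D. measure lborel K * ?f x) - integral (cbox a b) ?f\<bar> < e" if e: "e > 0" for e
  proof -
    let ?Z = "frontier A \<inter> cbox a b"
    have Z: "negligible ?Z" using neg by (rule negligible_subset) auto
    obtain U where U: "open U" "?Z \<subseteq> U" "U \<in> lmeasurable" "measure lebesgue U < e"
    proof -
      obtain U where U: "open U" "?Z \<subseteq> U" "U - ?Z \<in> lmeasurable" "emeasure lebesgue (U - ?Z) < ennreal e"
        using sets_lebesgue_outer_open[OF negligible_imp_sets[OF Z] e] by blast
      have "U = (U - ?Z) \<union> ?Z" using U(2) by blast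
      then have mU: "U \<in> lmeasurable"
        using fmeasurable.Un[OF U(3) negligible_imp_measurable[OF Z]] by simp
      have "measure lebesgue (U - ?Z) = measure lebesgue U"
        using U(2) Z by (intro measure_negligible_symdiff mU negligible_subset[OF Z]) auto
      moreover have "measure lebesgue (U - ?Z) < e"
        using U(3,4) e by (simp add: emeasure_eq_measure2 ennreal_less_iff)
      ultimately show thesis using that U(1,2) mU by simp
    qed
    have "compact ?Z" by (simp add: closed_Int_compact)
    \<comment> \<open>Compactness gives one radius for all frontier points, which a constant gauge
      requires.\<close>
    then obtain d where d: "d > 0" "(\<Union>z\<in>?Z. ball z d) \<subseteq> U"
      using compact_subset_open_imp_ball_epsilon_subset U by metis
    have intU: "indicat_real U integrable_on cbox a b"
      using U(3) by (simp add: integrable_on_indicator fmeasurable.Int)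
    have near: "\<bar>?f x - ?f p\<bar> \<le> indicator U p" if "x \<in> cbox a b" "p \<in> cbox a b" "dist x p < d" for x p
    proof (cases "x \<in> A \<longleftrightarrow> p \<in> A")
      case False
      have "closed_segment x p \<inter> frontier A \<noteq> {}"
        using False by (intro connected_Int_frontier) auto
      then obtain z where z: "z \<in> closed_segment x p" "z \<in> frontier A" by auto
      have "z \<in> cbox a b" using z(1) that closed_segment_subset[OF that(1,2) convex_box(1)] by auto
      moreover have "dist z p < d"
        using dist_in_closed_segment[OF z(1)] that(3) by (simp add: dist_commute)
      ultimately have "p \<in> U" using d(2) z(2) by (force simp: subset_iff)
      then show ?thesis by (simp add: indicator_def)
    qed (simp add: indicator_def)
    have "\<bar>(\<Sum>(x, K)\<in>D. measure lborel K * ?f x) - integral (cbox a b) ?f\<bar> < e"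
      if D: "D tagged_division_of cbox a b" and fine: "(\<lambda>x. ball x d) fine D" for D
    proof -
      have piece: "\<bar>measure lborel K * ?f x - integral K ?f\<bar> \<le> integral K (indicator U)" if xK: "(x, K) \<in> D" for x K
      proof -
        obtain u v where K: "K = cbox u v" using D xK by blast
        have sub: "K \<subseteq> cbox a b" "x \<in> K" using tagged_division_ofD[OF D] xK by auto
        have iK: "?f integrable_on K" "indicat_real U integrable_on K"
          using integrable_on_subcbox[OF int] integrable_on_subcbox[OF intU] sub K by auto
        have "measure lborel K * ?f x - integral K ?f = integral K (\<lambda>p. ?f x - ?f p)"
          using iK K Henstock_Kurzweil_Integration.integral_diff[OF Henstock_Kurzweil_Integration.integrable_const[of "?f x" u v], of ?f] by simp
        also have "norm \<dots> \<le> integral K (indicator U)"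
        proof (intro Henstock_Kurzweil_Integration.integral_norm_bound_integral)
          show "(\<lambda>p. ?f x - ?f p) integrable_on K" using iK K by (intro integrable_diff) auto
          fix p assume "p \<in> K"
          moreover have "K \<subseteq> ball x d" using fine xK by (auto simp: fine_def)
          ultimately show "norm (?f x - ?f p) \<le> indicator U p"
            unfolding real_norm_def using sub by (intro near) auto
        qed (use iK in auto)
        finally show ?thesis by simp
      qed
      have "(\<Sum>(x, K)\<in>D. measure lborel K * ?f x) - integral (cbox a b) ?f =
          (\<Sum>(x, K)\<in>D. measure lborel K * ?f x - integral K ?f)"
        unfolding integral_combine_tagged_division_topdown[OF int D] by (simp add: sum_subtractf split_beta)
      also have "\<bar>\<dots>\<bar> \<le> (\<Sum>(x, K)\<in>D. integral K (indicator U))"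
        by (rule order.trans[OF sum_abs]) (auto intro!: sum_mono piece)
      also have "\<dots> = integral (cbox a b) (indicator U)"
        by (rule integral_combine_tagged_division_topdown[OF intU D, symmetric])
      also have "\<dots> = measure lebesgue (U \<inter> cbox a b)"
        using U(3) by (intro Equivalence_Lebesgue_Henstock_Integration.integral_indicator fmeasurable.Int) auto
      also have "\<dots> \<le> measure lebesgue U"
        using U(3) by (intro measure_mono_fmeasurable) auto
      finally show ?thesis using U(4) by simp
    qed
    then show ?thesis using d(1) by blast
  qed
  then show ?thesis unfolding riemann_integrable_cbox_def by blast
qed

text \<open>Tonelli's theorem; closedness provides measurability.\<close>

lemma negligible_if_AE_AE:
  fixes Z :: "(real \<times> real) set"
  assumes "closed Z" "AE s in lborel. AE t in lborel. (s, t) \<notin> Z"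
  shows "negligible Z"
proof -
  have "AE p in lborel \<Otimes>\<^sub>M lborel. p \<notin> Z"
  proof (rule lborel_pair.AE_pair_measure)
    show "{p \<in> space (lborel \<Otimes>\<^sub>M lborel). p \<notin> Z} \<in> sets (lborel \<Otimes>\<^sub>M lborel)"
      using assms(1) unfolding lborel_prod by (simp add: closed_def borel_open Collect_neg_eq flip: Compl_eq)
  qed (use assms(2) in simp)
  from this[unfolded lborel_prod] have "AE p in lborel. p \<notin> Z" .
  then have "Z \<in> null_sets lborel" using AE_iff_null_sets[of Z lborel] assms(1) by (simp add: borel_closed)
  then show ?thesis by (simp add: negligible_iff_null_sets null_sets_completionI)
qed

lemma not_in_frontier_if_locally_constant:
  fixes p :: "'a::topological_space"
  assumes "eventually (\<lambda>q. q \<in> A \<longleftrightarrow> p \<in> A) (nhds p)"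
  shows "p \<notin> frontier A"
proof (cases "p \<in> A")
  case True
  then have "p \<in> interior A" using assms by (auto simp: eventually_nhds interior_def)
  then show ?thesis by (simp add: frontier_def)
next
  case False
  then have "p \<in> interior (- A)" using assms by (auto simp: eventually_nhds interior_def)
  then show ?thesis by (simp add: frontier_def interior_complement)
qed

text \<open>Expresses membership in the strip by two floors, which are locally constant off the
  integers.\<close>

lemma frac_less_iff_floor_neq:
  fixes \<alpha> z :: real
  assumes "0 < \<alpha>" "\<alpha> < 1"
  shows "frac z < \<alpha> \<longleftrightarrow> \<lfloor>z - \<alpha>\<rfloor> \<noteq> \<lfloor>z\<rfloor>"
  using assms unfolding frac_def by linarith


lemma tendsto_fst_nhds: "(fst \<longlongrightarrow> s) (nhds (s, t))"
  using tendsto_fst[OF filterlim_ident[of "nhds (s, t)"]] by simp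

lemma tendsto_snd_nhds: "(snd \<longlongrightarrow> t) (nhds (s, t))"
  using tendsto_snd[OF filterlim_ident[of "nhds (s, t)"]] by simp

text \<open>Over \<open>s\<close> outside \<open>N\<close>, membership is locally constant at
  \<open>(s, t)\<close> unless \<open>t - \<beta> s\<close> or
  \<open>t - \<beta> s - \<alpha>\<close> is an integer, which excludes only countably many
  \<open>t\<close>.\<close>

lemma negligible_frontier_strip:
  fixes \<beta> :: "real \<Rightarrow> real"
  assumes \<alpha>: "0 < \<alpha>" "\<alpha> < 1" and N: "countable N" and cont: "\<And>s. s \<notin> N \<Longrightarrow> isCont \<beta> s"
  shows "negligible (frontier {(s, t). frac (t - \<beta> s) < \<alpha>})"
proof (rule negligible_if_AE_AE)
  let ?A = "{(s, t). frac (t - \<beta> s) < \<alpha>}"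
  have countable_AE: "AE s in lborel. s \<notin> C" if "countable C" for C :: "real set"
    using countable_imp_null_set_lborel[OF that] by (rule AE_not_in)
  have "AE t in lborel. (s, t) \<notin> frontier ?A" if "s \<notin> N" for s
  proof -
    have "AE t in lborel. t \<notin> range (\<lambda>i. \<beta> s + of_int i) \<union> range (\<lambda>i. \<beta> s + \<alpha> + of_int i)"
      by (rule countable_AE) auto
    then show ?thesis
    proof eventually_elim
      fix t assume t: "t \<notin> range (\<lambda>i. \<beta> s + of_int i) \<union> range (\<lambda>i. \<beta> s + \<alpha> + of_int i)"
      have lim: "((\<lambda>q. snd q - \<beta> (fst q)) \<longlongrightarrow> t - \<beta> s) (nhds (s, t))"
        by (intro tendsto_diff tendsto_snd_nhds isCont_tendsto_compose[OF cont[OF that]] tendsto_fst_nhds)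
      have nonint: "t - \<beta> s \<notin> \<int>"
      proof
        assume "t - \<beta> s \<in> \<int>"
        then obtain i where "t - \<beta> s = of_int i" by (auto elim: Ints_cases)
        then have "t = \<beta> s + of_int i" by simp
        then show False using t by blast
      qed
      have "t - \<beta> s - \<alpha> \<notin> \<int>"
      proof
        assume "t - \<beta> s - \<alpha> \<in> \<int>"
        then obtain i where "t - \<beta> s - \<alpha> = of_int i" by (auto elim: Ints_cases)
        then have "t = \<beta> s + \<alpha> + of_int i" by simp
        then show False using t by blast
      qed
      then have "\<forall>\<^sub>F q in nhds (s, t). \<lfloor>snd q - \<beta> (fst q) - \<alpha>\<rfloor> = \<lfloor>t - \<beta> s - \<alpha>\<rfloor>"
        by (intro eventually_floor_eq tendsto_diff[OF lim tendsto_const])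
      moreover have "\<forall>\<^sub>F q in nhds (s, t). \<lfloor>snd q - \<beta> (fst q)\<rfloor> = \<lfloor>t - \<beta> s\<rfloor>"
        using nonint by (intro eventually_floor_eq lim)
      ultimately have "\<forall>\<^sub>F q in nhds (s, t). q \<in> ?A \<longleftrightarrow> (s, t) \<in> ?A"
        by eventually_elim (simp add: case_prod_beta frac_less_iff_floor_neq[OF \<alpha>])
      then show "(s, t) \<notin> frontier ?A" by (rule not_in_frontier_if_locally_constant)
    qed
  qed
  then show "AE s in lborel. AE t in lborel. (s, t) \<notin> frontier ?A"
    using countable_AE[OF N] by (auto elim: eventually_mono)
qed simp

section \<open>Strips: Riemann integrability and first marginal\<close>

definition strip :: "(real \<Rightarrow> real) \<Rightarrow> real \<Rightarrow> circle \<times> circle \<Rightarrow> real"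
  where "strip \<beta> \<alpha> = (\<lambda>(x, y). of_bool (frac (crep y - \<beta> (crep x)) < \<alpha>))"

lemma range_strip: "range (strip \<beta> \<alpha>) \<subseteq> {0..1}"
  by (auto simp: strip_def)

lemma riemann_integrable_strip:
  assumes \<alpha>: "0 < \<alpha>" "\<alpha> < 1" and N: "countable N" and cont: "\<And>s. s \<notin> N \<Longrightarrow> isCont \<beta> s"
    and periodic: "\<And>s. \<beta> (frac s) = \<beta> s"
  shows "riemann_integrable_torus (strip \<beta> \<alpha>)"
proof -
  have "frac (frac t - \<beta> s) = frac (t - \<beta> s)" for s t
    by (rule frac_eqI) (simp add: frac_def)
  then have "(\<lambda>(s, t). strip \<beta> \<alpha> (to_circle s, to_circle t)) = indicator {(s, t). frac (t - \<beta> s) < \<alpha>}"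
    by (auto simp: strip_def crep_to_circle periodic indicator_def)
  then show ?thesis
    unfolding riemann_integrable_torus_def
    using riemann_integrable_indicator[OF negligible_frontier_strip[OF \<alpha> N cont]] by simp
qed

text \<open>Rotation invariance reduces the claim to the arc starting at \<open>0\<close>.\<close>

lemma emeasure_circle_arc:
  assumes "0 \<le> \<alpha>" "\<alpha> \<le> 1"
  shows "emeasure circle_measure {y. frac (crep y - b) < \<alpha>} = ennreal \<alpha>"
proof -
  have m: "{y. crep y < \<alpha>} \<in> sets borel"
    using borel_measurable_less[OF crep_measurable borel_measurable_const[of \<alpha>]] by (simp add: measurable_def pred_def)
  have "crep (to_circle (- b) + y) = frac (crep y - b)" for y
  proof -
    have "to_circle (- b) + y = to_circle (crep y - b)"
      using to_circle_add[of "- b" "crep y"] by simp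
    then show ?thesis by (simp add: crep_to_circle)
  qed
  then have "{y. frac (crep y - b) < \<alpha>} = (+) (to_circle (- b)) -` {y. crep y < \<alpha>}" by auto
  also have "emeasure circle_measure \<dots> = emeasure circle_measure {y. crep y < \<alpha>}"
    by (rule circle_measure_translate[OF m])
  also have "\<dots> = emeasure lborel (to_circle -` {y. crep y < \<alpha>} \<inter> {0..<1})"
    by (rule emeasure_circle_measure[OF m])
  also have "to_circle -` {y. crep y < \<alpha>} \<inter> {0..<1} = {0..<\<alpha>}"
    using assms by (auto simp: crep_to_circle frac_eq[THEN iffD2])
  finally show ?thesis using assms by simp
qed

lemma circle_arc_borel: "{y. frac (crep y - b) < \<alpha>} \<in> sets borel"
proof -
  have "(\<lambda>y. frac (crep y - b)) \<in> borel_measurable borel"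
    unfolding frac_def by measurable
  from borel_measurable_less[OF this borel_measurable_const[of \<alpha>]]
  show ?thesis by (simp add: measurable_def pred_def)
qed

lemma constant_first_marginal_strip:
  assumes "0 \<le> \<alpha>" "\<alpha> \<le> 1"
  shows "constant_first_marginal (strip \<beta> \<alpha>) \<alpha>"
proof -
  have "has_bochner_integral (completion circle_measure) (\<lambda>y. strip \<beta> \<alpha> (x, y)) \<alpha>" for x
  proof -
    let ?A = "{y. frac (crep y - \<beta> (crep x)) < \<alpha>}"
    have A: "?A \<in> sets circle_measure" using circle_arc_borel by simp
    have eq: "(\<lambda>y. strip \<beta> \<alpha> (x, y)) = indicator ?A" by (auto simp: strip_def indicator_def)
    have "has_bochner_integral circle_measure (indicator ?A) (measure circle_measure ?A)"
      using A emeasure_circle_arc[OF assms] by (intro has_bochner_integral_real_indicator) auto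
    moreover have "measure circle_measure ?A = \<alpha>"
      using emeasure_circle_arc[OF assms] assms by (simp add: measure_def)
    moreover have m: "indicat_real ?A \<in> borel_measurable circle_measure" using A by simp
    ultimately show ?thesis
      unfolding eq has_bochner_integral_iff integrable_completion[OF m] integral_completion[OF m] by simp
  qed
  then show ?thesis by (simp add: constant_first_marginal_def)
qed

section \<open>The Haar measure in coordinates and bounds for the pattern density\<close>

lemma haar_V_eq:
  assumes "k \<ge> 1"
  shows "haar_V k = distr (PiM {0..k} (\<lambda>_. circle_measure)) (restrict_space (torus_borel k) (V k)) (V_param k)"
  using is_haar_V_unique[OF is_haar_V_haar_V[OF assms] is_haar_V_exists[OF assms]] .

text \<open>The Haar measure is the image of a product of circle measures under
  \<open>V_param\<close>, so each parameter is uniformly distributed; \<open>g\<close> reads it off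
  the point of \<open>V k\<close>.\<close>

lemma measure_haar_V_vimage:
  assumes k: "k \<ge> 1" and g: "g \<in> borel_measurable (torus_borel k)" and j: "j \<le> k"
    and gj: "\<And>q. g (V_param k q) = q j" and S: "S \<in> sets borel"
  shows "g -` S \<inter> V k \<in> sets (haar_V k)" "measure (haar_V k) (g -` S \<inter> V k) = measure circle_measure S"
proof -
  let ?N = "PiM {0..k} (\<lambda>_. circle_measure)" and ?R = "restrict_space (torus_borel k) (V k)"
  have "V_param k \<in> measurable ?N (torus_borel k)"
    unfolding V_param_def torus_borel_def using k by measurable
  then have \<phi>: "V_param k \<in> measurable ?N ?R"
    using V_param_in_V[OF k] by (intro measurable_restrict_space2) auto
  have "g \<in> borel_measurable ?R" using g by (rule measurable_restrict_space1)
  from measurable_sets[OF this S] have E: "g -` S \<inter> V k \<in> sets ?R"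
    using V_subset[of k] by (simp add: space_restrict_space Int_absorb2)
  then show "g -` S \<inter> V k \<in> sets (haar_V k)" by (simp add: haar_V_eq[OF k])
  have "measure (haar_V k) (g -` S \<inter> V k) = measure ?N (V_param k -` (g -` S \<inter> V k) \<inter> space ?N)"
    unfolding haar_V_eq[OF k] by (rule measure_distr[OF \<phi> E])
  also have "V_param k -` (g -` S \<inter> V k) \<inter> space ?N = (\<lambda>q. q j) -` S \<inter> space ?N"
    using V_param_in_V[OF k] gj by (auto simp flip: gj)
  also have "measure ?N \<dots> = measure (distr ?N circle_measure (\<lambda>q. q j)) S"
    using S j by (intro measure_distr[symmetric] measurable_component_singleton) auto
  also have "distr ?N circle_measure (\<lambda>q. q j) = circle_measure"
    using j by (intro distr_PiM_component[of "{0..k}" "\<lambda>_. circle_measure"] prob_space_circle_measure) auto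
  finally show "measure (haar_V k) (g -` S \<inter> V k) = measure circle_measure S" .
qed

lemma Lambda_tilde_nonneg:
  assumes "range F \<subseteq> {0..1}"
  shows "0 \<le> Lambda_tilde k F"
proof -
  have "0 \<le> F p" for p using assms by (auto simp: subset_iff)
  then show ?thesis unfolding Lambda_tilde_def by (intro Bochner_Integration.integral_nonneg) (auto intro: prod_nonneg)
qed

lemma rho_tilde_le:
  assumes "range F \<subseteq> {0..1}" "riemann_integrable_torus F" "constant_first_marginal F \<alpha>"
  shows "rho_tilde k \<alpha> \<le> Lambda_tilde k F"
  unfolding rho_tilde_def
proof (rule cInf_lower)
  show "bdd_below {Lambda_tilde k F |F. range F \<subseteq> {0..1} \<and> riemann_integrable_torus F \<and> constant_first_marginal F \<alpha>}"
    using Lambda_tilde_nonneg by (intro bdd_belowI[of _ 0]) auto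
qed (use assms in blast)

text \<open>The integrand is at most \<open>1\<close> and vanishes unless the parameter lies in
  \<open>S\<close>. Both upper bounds for the density below arise this way.\<close>

lemma Lambda_tilde_le_measure:
  assumes k: "k \<ge> 1" and g: "g \<in> borel_measurable (torus_borel k)" and j: "j \<le> k"
    and gj: "\<And>q. g (V_param k q) = q j" and S: "S \<in> sets borel"
    and F: "range F \<subseteq> {0..1}"
    and supp: "\<And>q. (\<And>i. i \<in> {1..k} \<Longrightarrow> F (fst (V_param k q) i, snd (V_param k q) i) \<noteq> 0) \<Longrightarrow> q j \<in> S"
  shows "Lambda_tilde k F \<le> measure circle_measure S"
proof -
  let ?G = "\<lambda>v. case v of (x, y) \<Rightarrow> (\<Prod>i=1..k. F (x i, y i))"
  let ?E = "g -` S \<inter> V k"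
  note E = measure_haar_V_vimage[OF k g j gj S]
  interpret prob_space "haar_V k" using is_haar_V_haar_V[OF k] by (simp add: is_haar_V_def)
  have Fb: "0 \<le> F p" "F p \<le> 1" for p using F by (auto simp: subset_iff)
  show ?thesis
  proof (cases "integrable (completion (haar_V k)) ?G")
    case True
    have "?G v \<le> indicator ?E v" if "v \<in> space (completion (haar_V k))" for v
    proof -
      have v: "v \<in> V k" using that is_haar_V_space[OF is_haar_V_haar_V[OF k]] by simp
      then obtain q where q: "V_param k q = v" using V_param_surj[OF k] by blast
      show ?thesis
      proof (cases "v \<in> ?E")
        case True
        then show ?thesis using Fb by (auto simp: case_prod_beta intro!: prod_le_1)
      next
        case False
        then have "q j \<notin> S" using v gj[of q] q by auto
        then obtain i where "i \<in> {1..k}" "F (fst v i, snd v i) = 0" using supp[of q] q by auto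
        then have "?G v = 0" by (auto simp: case_prod_beta intro!: prod_zero)
        then show ?thesis by simp
      qed
    qed
    moreover have "integrable (completion (haar_V k)) (indicat_real ?E)"
      using E(1) emeasure_eq_measure by (subst integrable_completion) (auto intro!: integrable_real_indicator)
    ultimately have "Lambda_tilde k F \<le> integral\<^sup>L (completion (haar_V k)) (indicat_real ?E)"
      unfolding Lambda_tilde_def using True by (intro integral_mono) auto
    also have "\<dots> = integral\<^sup>L (haar_V k) (indicat_real ?E)"
      using E(1) by (intro integral_completion) auto
    also have "\<dots> = measure (haar_V k) ?E"
      using is_haar_V_space[OF is_haar_V_haar_V[OF k]] by (simp add: Int_absorb2)
    finally show ?thesis using E(2) by simp
  next
    \<comment> \<open>The Bochner integral of a nonintegrable function is \<open>0\<close> by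
      convention.\<close>
    case False
    then show ?thesis by (simp add: Lambda_tilde_def not_integrable_integral_eq)
  qed
qed

section \<open>Regularity of the offset strip\<close>

lemma isCont_offset:
  assumes LM: "L \<ge> 1" "M \<ge> 1" and s: "\<And>l. l < D \<Longrightarrow> real L * (real M ^ l * s) \<notin> \<int>"
  shows "isCont (offset n L M D) s"
proof -
  have nonint: "real M ^ l * s \<notin> \<int>" if "l < D" for l
    using s[OF that] by (metis Ints_mult Ints_of_nat)
  have frac_cont: "isCont (\<lambda>x. frac (real M ^ l * x)) s" if "l < D" for l
    by (intro isCont_o2[where f = "\<lambda>x. real M ^ l * x" and g = frac] continuous_frac nonint that continuous_intros)
  have cell_const: "\<forall>\<^sub>F x in nhds s. cell L (real M ^ l * x) = cell L (real M ^ l * s)" if "l < D" for l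
  proof -
    have "((\<lambda>x. real L * frac (real M ^ l * x)) \<longlongrightarrow> real L * frac (real M ^ l * s)) (nhds s)"
      using frac_cont[OF that] by (intro tendsto_mult tendsto_const) (simp add: continuous_within tendsto_nhds_iff)
    moreover have "real L * frac (real M ^ l * s) \<notin> \<int>"
    proof
      assume "real L * frac (real M ^ l * s) \<in> \<int>"
      then have "real L * frac (real M ^ l * s) + of_int (int L * \<lfloor>real M ^ l * s\<rfloor>) \<in> \<int>"
        by (intro Ints_add Ints_of_int)
      then show False using s[OF that] by (simp add: frac_def algebra_simps)
    qed
    ultimately show ?thesis unfolding cell_def by (rule eventually_mono[OF eventually_floor_eq]) simp
  qed
  \<comment> \<open>Near \<open>s\<close> every dilate stays in its cell, so \<open>code\<close> is
    constant and only \<open>weight\<close> varies.\<close>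
  have "\<forall>\<^sub>F x in nhds s. \<forall>r\<in>{..<D * L}. cell L (real M ^ (r div L) * x) = cell L (real M ^ (r div L) * s)"
    by (intro eventually_ball_finite ballI cell_const) (auto simp: less_mult_imp_div_less)
  then have ev: "\<forall>\<^sub>F x in nhds s. offset n L M D x =
      (real (code n L M D s) + weight M D x / (3 * real D * 2 ^ (n + 2))) / (2 ^ (n + 3)) ^ (D * L + 1)"
    by eventually_elim (simp add: offset_def code_def)
  have "isCont (weight M D) s"
    unfolding weight_def by (intro continuous_intros frac_cont) auto
  then have "isCont (\<lambda>x. (real (code n L M D s) + weight M D x / (3 * real D * 2 ^ (n + 2))) / (2 ^ (n + 3)) ^ (D * L + 1)) s"
    unfolding divide_inverse by (intro continuous_intros)
  then show ?thesis using isCont_cong[OF ev] by simp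
qed

lemma riemann_integrable_offset_strip:
  assumes "0 < \<alpha>" "\<alpha> < 1" "L \<ge> 1" "M \<ge> 1"
  shows "riemann_integrable_torus (strip (offset n L M D) \<alpha>)"
proof (rule riemann_integrable_strip[OF assms(1,2)])
  \<comment> \<open>These are the points with some dilate on a cell boundary.\<close>
  let ?N = "\<Union>l<D. range (\<lambda>i::int. of_int i / (real L * real M ^ l))"
  show "countable ?N" by auto
  show "isCont (offset n L M D) s" if "s \<notin> ?N" for s
  proof (rule isCont_offset[OF assms(3,4)])
    fix l assume l: "l < D"
    show "real L * (real M ^ l * s) \<notin> \<int>"
    proof
      assume "real L * (real M ^ l * s) \<in> \<int>"
      then obtain i where "real L * (real M ^ l * s) = of_int i" by (auto elim: Ints_cases)
      then have "s = of_int i / (real L * real M ^ l)" using assms(3,4) by (simp add: field_simps)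
      then show False using that l by blast
    qed
  qed
qed (rule offset_frac)

section \<open>Density of patterns in the offset strip\<close>

lemma to_circle_sum: "to_circle (\<Sum>i\<in>I. f i) = (\<Sum>i\<in>I. to_circle (f i))"
  by (induction I rule: infinite_finite_induct) (simp_all add: to_circle_add zero_circle_def)

lemma int_scale_to_circle: "int_scale m (to_circle r) = to_circle (of_int m * r)"
  by (rule int_scale.abs_eq)

text \<open>The relation defining \<open>V\<close>, lifted to representatives in
  \<open>[0, 1)\<close>. Shifting the indices from \<open>1..k\<close> to \<open>0..n\<close>
  reverses all signs, hence the minus sign in the proof.\<close>

lemma V_param_second_sum_Ints:
  fixes n :: nat and q :: "nat \<Rightarrow> circle"
  defines "y \<equiv> snd (V_param (Suc n) q)"
  shows "(\<Sum>i\<le>n. (-1) ^ i * real (n choose i) * crep (y (Suc i))) \<in> \<int>"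
proof -
  have "(\<Sum>i=1..Suc n. int_scale ((-1) ^ i * int (n choose (i - 1))) (y i)) = 0"
    using V_param_in_V[of "Suc n" q] by (auto simp: V_def y_def)
  then have "(\<Sum>i\<le>n. int_scale ((-1) ^ Suc i * int (n choose i)) (y (Suc i))) = 0"
    by (simp only: One_nat_def sum.atLeast_Suc_atMost_Suc_shift o_def diff_Suc_Suc diff_zero atLeast0AtMost)
  also have "(\<Sum>i\<le>n. int_scale ((-1) ^ Suc i * int (n choose i)) (y (Suc i))) =
      to_circle (\<Sum>i\<le>n. of_int ((-1) ^ Suc i * int (n choose i)) * crep (y (Suc i)))"
    unfolding to_circle_sum int_scale_to_circle[symmetric] to_circle_crep ..
  finally have "(\<Sum>i\<le>n. of_int ((-1) ^ Suc i * int (n choose i)) * crep (y (Suc i))) \<in> \<int>"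
    by (simp only: zero_circle_def to_circle_eq_iff diff_0_right)
  then have "- (\<Sum>i\<le>n. (-1) ^ i * real (n choose i) * crep (y (Suc i))) \<in> \<int>"
    by (simp add: sum_negf)
  then show ?thesis by (simp only: minus_in_Ints_iff)
qed

lemma crep_V_param_first:
  assumes "i \<le> n" "q 0 = to_circle t" "q 1 = to_circle d"
  shows "crep (fst (V_param (Suc n) q) (Suc i)) = frac (t + real i * d)"
  using assms by (simp add: V_param_def int_scale_to_circle to_circle_add[symmetric] crep_to_circle)

text \<open>The common difference is confined to the arc of half-width
  \<open>1 / (2 * M ^ D)\<close> around \<open>0\<close>, and the bound is the length of this
  arc.\<close>

lemma Lambda_tilde_offset_strip_le:
  fixes n L M D :: nat and \<alpha> :: real
  defines "Bp \<equiv> (2 ^ (n + 3)) ^ (D * L + 1) :: real"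
  assumes n: "n \<ge> 1" "even n" and L: "L > 0" and D: "D \<ge> 1" and M: "M \<ge> 1"
    and no_wrap: "\<And>t d i. \<bar>d\<bar> \<le> 1 / 2 \<Longrightarrow> cells_vanish n L (\<lambda>i. t + real i * d) \<Longrightarrow> i \<le> n \<Longrightarrow>
      frac (t + real i * d) = frac t + real i * d"
    and small1: "2 ^ n * \<alpha> * Bp \<le> 1 / 4"
    and small2: "2 ^ n * \<alpha> * Bp * (3 * real D * 2 ^ (n + 2)) < (1 / (4 * real M)) ^ n"
  shows "Lambda_tilde (Suc n) (strip (offset n L M D) \<alpha>) \<le> 1 / real M ^ D"
proof -
  define \<eta> where "\<eta> = 1 / (2 * real M ^ D)"
  define S where "S = {y. frac (crep y - (- \<eta>)) < 2 * \<eta>}"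
  have \<eta>: "0 < \<eta>" "2 * \<eta> \<le> 1" using M by (auto simp: \<eta>_def divide_le_eq)
  have S: "S \<in> sets borel" unfolding S_def by (rule circle_arc_borel)
  \<comment> \<open>The common difference \<open>x_2 - x_1\<close>, with subtraction written through
    \<open>int_scale (- 1)\<close> so that measurability of sums and integer multiples
    applies.\<close>
  let ?g = "\<lambda>v :: torus_point. fst v 2 + int_scale (- 1) (fst v 1)"
  have "Lambda_tilde (Suc n) (strip (offset n L M D) \<alpha>) \<le> measure circle_measure S"
  proof (rule Lambda_tilde_le_measure[OF _ _ _ _ S range_strip, where g = ?g and j = 1])
    have "(\<lambda>v. fst v i) \<in> borel_measurable (torus_borel (Suc n))" if "i \<in> {1..Suc n}" for i
      unfolding torus_borel_def using that by measurable
    then show "?g \<in> borel_measurable (torus_borel (Suc n))"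
      using n by (intro circle_add_measurable circle_scale_measurable) auto
    show "?g (V_param (Suc n) q) = q 1" for q
      using n by (simp add: V_param_def)
  next
    fix q :: "nat \<Rightarrow> circle"
    let ?x = "fst (V_param (Suc n) q)" and ?y = "snd (V_param (Suc n) q)"
    assume nz: "\<And>i. i \<in> {1..Suc n} \<Longrightarrow> strip (offset n L M D) \<alpha> (?x i, ?y i) \<noteq> 0"
    define t where "t = crep (q 0)"
    define d where "d = crep (q 1) - of_int (round (crep (q 1)))"
    have q: "q 0 = to_circle t" "q 1 = to_circle d"
    proof -
      have "to_circle d = to_circle (crep (q 1))" unfolding to_circle_eq_iff by (simp add: d_def)
      then show "q 1 = to_circle d" by simp
    qed (simp add: t_def)
    have d: "\<bar>d\<bar> \<le> 1 / 2" using of_int_round_abs_le[of "crep (q 1)"] by (simp add: d_def abs_minus_commute)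
    define \<theta> where "\<theta> i = frac (crep (?y (Suc i)) - offset n L M D (t + real i * d))" for i
    have "\<theta> i < \<alpha>" if "i \<le> n" for i
      using nz[of "Suc i"] that
      by (simp add: strip_def \<theta>_def crep_V_param_first[OF that q] offset_frac split: if_splits)
    then have \<theta>: "\<bar>\<theta> i\<bar> \<le> \<alpha>" if "i \<le> n" for i using that by (simp add: \<theta>_def less_imp_le)
    let ?c = "\<lambda>i. (-1) ^ i * real (n choose i)"
    \<comment> \<open>Up to the integers removed by \<open>frac\<close>, offset plus
      \<open>\<theta> i\<close> is the second coordinate, so the relation of \<open>V\<close> makes
      this sum an integer.\<close>
    have "(\<Sum>i\<le>n. ?c i * (offset n L M D (t + real i * d) + \<theta> i)) =
        (\<Sum>i\<le>n. ?c i * crep (?y (Suc i))) -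
        of_int (\<Sum>i\<le>n. (-1) ^ i * int (n choose i) * \<lfloor>crep (?y (Suc i)) - offset n L M D (t + real i * d)\<rfloor>)"
      by (simp add: \<theta>_def frac_def right_diff_distrib flip: sum_subtractf)
    also have "\<dots> \<in> \<int>" by (intro Ints_diff V_param_second_sum_Ints Ints_of_int)
    finally have "\<bar>d\<bar> < \<eta>"
      unfolding \<eta>_def
      using pattern_forces_small_difference[of n L D M \<theta> \<alpha> t d] n L D M no_wrap \<theta> d small1 small2
      by (simp add: Bp_def)
    have "frac (crep (q 1) - (- \<eta>)) = frac (d + \<eta>)"
      by (rule frac_eqI) (simp add: d_def)
    also have "\<dots> = d + \<eta>"
      unfolding frac_eq using \<open>\<bar>d\<bar> < \<eta>\<close> \<eta>(2) by linarith
    finally show "q 1 \<in> S" using \<open>\<bar>d\<bar> < \<eta>\<close> by (simp add: S_def)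
  qed (use n in auto)
  also have "measure circle_measure S = 2 * \<eta>"
    using emeasure_circle_arc[of "2 * \<eta>" "- \<eta>"] \<eta> by (simp add: S_def measure_def)
  finally show ?thesis by (simp add: \<eta>_def)
qed

text \<open>In the flat strip the condition on \<open>y_2\<close> alone has probability
  \<open>\<alpha>\<close>: \<open>V_param\<close> solves for \<open>y_1\<close> and leaves
  \<open>y_2\<close> free. This serves for \<open>\<alpha>\<close> bounded away from
  \<open>0\<close>.\<close>

lemma rho_tilde_le_density:
  assumes k: "k \<ge> 2" and \<alpha>: "0 < \<alpha>" "\<alpha> < 1"
  shows "rho_tilde k \<alpha> \<le> \<alpha>"
proof -
  let ?S = "{y. frac (crep y - 0) < \<alpha>}"
  have "rho_tilde k \<alpha> \<le> Lambda_tilde k (strip (\<lambda>_. 0) \<alpha>)"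
    using \<alpha> by (intro rho_tilde_le range_strip riemann_integrable_strip[where N = "{}"] constant_first_marginal_strip) auto
  also have "\<dots> \<le> measure circle_measure ?S"
  proof (rule Lambda_tilde_le_measure[where g = "\<lambda>v. snd v 2" and j = 2, OF _ _ _ _ circle_arc_borel range_strip])
    have "2 \<in> {1..k}" using k by simp
    then show "(\<lambda>v. snd v 2) \<in> borel_measurable (torus_borel k)"
      unfolding torus_borel_def by measurable
    show V2: "snd (V_param k q) 2 = q 2" for q
      using k by (simp add: V_param_def)
    show "q 2 \<in> ?S" if "\<And>i. i \<in> {1..k} \<Longrightarrow> strip (\<lambda>_. 0) \<alpha> (fst (V_param k q) i, snd (V_param k q) i) \<noteq> 0" for q
      using that[of 2] k by (simp add: strip_def V2 split: if_splits)
  qed (use k in auto)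
  also have "\<dots> = \<alpha>" using emeasure_circle_arc[of \<alpha> 0] \<alpha> by (simp add: measure_def)
  finally show ?thesis .
qed

section \<open>Choice of the parameters\<close>

text \<open>With \<open>X = ln (1 / \<alpha>)\<close>, take \<open>D\<close> about
  \<open>X / h\<close> and \<open>M\<close> about \<open>exp (X / (16 * n))\<close>. The digits cost
  \<open>exp (X / 2)\<close> and \<open>M ^ n\<close> about \<open>exp (X / 16)\<close>, within the
  gain \<open>exp X\<close> from \<open>1 / \<alpha>\<close>, while \<open>M ^ D\<close> is
  exponential in \<open>X ^ 2\<close>.\<close>

lemma parameters_exist:
  fixes n L :: nat
  assumes n: "n \<ge> 1" and L: "L \<ge> 1"
  shows "\<exists>c>0. \<exists>X0>0. \<forall>\<alpha>. 0 < \<alpha> \<and> X0 \<le> ln (1 / \<alpha>) \<longrightarrow> (\<exists>M\<ge>1. \<exists>D\<ge>1.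
    2 ^ n * \<alpha> * (2 ^ (n + 3)) ^ (D * L + 1) \<le> 1 / 4 \<and>
    2 ^ n * \<alpha> * (2 ^ (n + 3)) ^ (D * L + 1) * (3 * real D * 2 ^ (n + 2)) < (1 / (4 * real M)) ^ n \<and>
    1 / real M ^ D \<le> exp (- (c * ln (1 / \<alpha>) ^ 2)))"
proof -
  define B where "B = (2 :: real) ^ (n + 3)"
  define b where "b = ln B"
  have B: "B > 1" unfolding B_def by (intro one_less_power) auto
  then have b: "b > 0" by (simp add: b_def)
  \<comment> \<open>Chosen so that \<open>D \<le> X / h\<close> gives
    \<open>B ^ (D * L) \<le> exp (X / 2)\<close>.\<close>
  define h where "h = 2 * real L * b"
  have h: "h > 0" using L b by (simp add: h_def)
  \<comment> \<open>Collects the constants of the second inequality; \<open>8 ^ n\<close> comes from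
    \<open>4 * M \<le> 8 * exp (X / (16 * n))\<close>.\<close>
  define K where "K = 2 ^ n * B * (3 * 2 ^ (n + 2)) * (1 / h) * 8 ^ n"
  \<comment> \<open>The product of the rate \<open>1 / (16 * n)\<close> of \<open>ln M\<close> and
    the rate \<open>1 / (2 * h)\<close> bounding \<open>D\<close> from below.\<close>
  define c where "c = 1 / (32 * real n * h)"
  have c: "c > 0" using n h by (simp add: c_def)
  have "((\<lambda>X :: real. 2 ^ n * B * exp (- X / 2)) \<longlongrightarrow> 0) at_top"
    by (rule tendsto_mult_right_zero) real_asymp
  then have ev1: "\<forall>\<^sub>F X in at_top. 2 ^ n * B * exp (- X / 2) < 1 / 4" by (rule order_tendstoD) simp
  \<comment> \<open>The rate is \<open>7 / 16 = 1 / 2 - 1 / 16\<close>, the decay left after paying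
    for \<open>M ^ n\<close>.\<close>
  have "((\<lambda>X :: real. K * (X * exp (- 7 / 16 * X))) \<longlongrightarrow> 0) at_top"
    by (rule tendsto_mult_right_zero) real_asymp
  then have ev2: "\<forall>\<^sub>F X in at_top. K * (X * exp (- 7 / 16 * X)) < 1" by (rule order_tendstoD) simp
  \<comment> \<open>For \<open>X / h \<ge> 2\<close> rounding down loses at most half, so
    \<open>D \<ge> X / (2 * h)\<close>.\<close>
  have "\<forall>\<^sub>F X in at_top. 2 * h \<le> X" by (rule eventually_ge_at_top)
  with ev1 ev2 have "\<forall>\<^sub>F X in at_top. 2 ^ n * B * exp (- X / 2) < 1 / 4 \<and>
      K * (X * exp (- 7 / 16 * X)) < 1 \<and> 2 * h \<le> X"
    by eventually_elim simp
  then obtain X0 where X0: "\<And>X. X \<ge> X0 \<Longrightarrow> 2 ^ n * B * exp (- X / 2) < 1 / 4 \<and>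
      K * (X * exp (- 7 / 16 * X)) < 1 \<and> 2 * h \<le> X"
    by (auto simp: eventually_at_top_linorder)
  have "\<exists>M\<ge>1. \<exists>D\<ge>1. 2 ^ n * \<alpha> * B ^ (D * L + 1) \<le> 1 / 4 \<and>
    2 ^ n * \<alpha> * B ^ (D * L + 1) * (3 * real D * 2 ^ (n + 2)) < (1 / (4 * real M)) ^ n \<and>
    1 / real M ^ D \<le> exp (- (c * ln (1 / \<alpha>) ^ 2))"
    if \<alpha>: "\<alpha> > 0" and X: "X0 \<le> ln (1 / \<alpha>)" for \<alpha>
  proof -
    define X where "X = ln (1 / \<alpha>)"
    have \<alpha>X: "\<alpha> = exp (- X)" using \<alpha> by (simp add: X_def ln_div)
    note X = X0[OF that(2), folded X_def]
    define D where "D = nat \<lfloor>X / h\<rfloor>"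
    define M where "M = nat \<lceil>exp (X / (16 * real n))\<rceil>"
    have Xh: "2 \<le> X / h" using X h by (simp add: field_simps)
    have D_upper: "real D \<le> X / h" using Xh by (simp add: D_def)
    have D_lower: "X / (2 * h) \<le> real D"
    proof -
      have "X / h - 1 \<le> real D" unfolding D_def by linarith
      then show ?thesis using Xh by simp
    qed
    have D1: "D \<ge> 1" using Xh by (simp add: D_def le_nat_iff le_floor_iff)
    have "X > 0" using X h by simp
    have M_lower: "exp (X / (16 * real n)) \<le> real M" unfolding M_def by (rule of_nat_ceiling)
    have e1: "1 \<le> exp (X / (16 * real n))" using \<open>X > 0\<close> n by simp
    have M_upper: "real M \<le> 2 * exp (X / (16 * real n))"
      using e1 unfolding M_def by linarith
    have M1: "M \<ge> 1" using M_lower e1 by linarith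
    have BDL: "B ^ (D * L) \<le> exp (X / 2)"
    proof -
      have "B ^ (D * L) = exp (real (D * L) * b)" using B by (simp only: b_def exp_of_nat_mult exp_ln)
      also have "real (D * L) * b = real D * (h / 2)" by (simp add: h_def)
      also have "\<dots> \<le> X / h * (h / 2)" using D_upper h by (intro mult_right_mono) auto
      also have "\<dots> = X / 2" using h by simp
      finally show ?thesis by simp
    qed
    have small: "2 ^ n * \<alpha> * B ^ (D * L + 1) \<le> 2 ^ n * B * exp (- X / 2)"
    proof -
      have "2 ^ n * \<alpha> * B ^ (D * L + 1) = 2 ^ n * B * (exp (- X) * B ^ (D * L))" by (simp add: \<alpha>X)
      also have "\<dots> \<le> 2 ^ n * B * (exp (- X) * exp (X / 2))" using BDL B by (intro mult_left_mono) auto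
      also have "exp (- X) * exp (X / 2) = exp (- X / 2)" by (simp flip: exp_add)
      finally show ?thesis .
    qed
    have "2 ^ n * \<alpha> * B ^ (D * L + 1) * (3 * real D * 2 ^ (n + 2)) \<le>
        2 ^ n * B * exp (- X / 2) * (3 * (X / h) * 2 ^ (n + 2))"
      using B by (intro mult_mono[OF small] mult_right_mono mult_left_mono D_upper) auto
    also have "\<dots> = K * (X * exp (- 7 / 16 * X)) * (exp (- X / 16) / 8 ^ n)"
    proof -
      have "exp (- X / 2) = exp (- 7 / 16 * X) * exp (- X / 16)" by (simp flip: exp_add)
      then show ?thesis by (simp add: K_def field_simps)
    qed
    also have "\<dots> < 1 * (exp (- X / 16) / 8 ^ n)"
      using X by (intro mult_strict_right_mono) auto
    also have "1 * (exp (- X / 16) / 8 ^ n) = (1 / (8 * exp (X / (16 * real n)))) ^ n"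
      using n by (simp add: power_divide power_mult_distrib exp_minus field_simps flip: exp_of_nat_mult)
    also have "\<dots> \<le> (1 / (4 * real M)) ^ n"
      using M_upper M1 by (intro power_mono divide_left_mono) auto
    finally have small2: "2 ^ n * \<alpha> * B ^ (D * L + 1) * (3 * real D * 2 ^ (n + 2)) < (1 / (4 * real M)) ^ n" .
    have "exp (c * X ^ 2) = exp (X / (16 * real n) * (X / (2 * h)))"
      by (simp add: c_def power2_eq_square)
    also have "\<dots> \<le> exp (X / (16 * real n) * real D)"
      unfolding exp_le_cancel_iff using \<open>X > 0\<close> by (intro mult_left_mono[OF D_lower]) simp
    also have "\<dots> = exp (X / (16 * real n)) ^ D" by (rule exp_of_nat2_mult)
    also have "\<dots> \<le> real M ^ D" using M_lower by (intro power_mono) auto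
    finally have "1 / real M ^ D \<le> exp (- (c * X ^ 2))"
      using M1 by (simp add: exp_minus field_simps)
    then have "1 / real M ^ D \<le> exp (- (c * ln (1 / \<alpha>) ^ 2))" unfolding X_def .
    moreover have "2 ^ n * \<alpha> * B ^ (D * L + 1) \<le> 1 / 4" using small X by linarith
    ultimately show ?thesis using M1 D1 small2 by blast
  qed
  then show ?thesis unfolding B_def
    by (intro exI[of _ c] exI[of _ "max X0 1"] conjI c) auto
qed

theorem theorem2p6:
  fixes k :: nat
  assumes "k \<ge> 5" and "odd k"
  shows "\<exists>c>0. \<forall>\<alpha>. 0 < \<alpha> \<and> \<alpha> < 1 / 2 \<longrightarrow> rho_tilde k \<alpha> \<le> \<alpha> powr (c * ln (1 / \<alpha>))"
proof -
  define n where "n = k - 1"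
  have n: "k = Suc n" "n \<ge> 1" "even n" using assms by (auto simp: n_def)
  obtain L where L: "L > 0" and no_wrap: "\<And>t d i. \<bar>d\<bar> \<le> 1 / 2 \<Longrightarrow>
      cells_vanish n L (\<lambda>i. t + real i * d) \<Longrightarrow> i \<le> n \<Longrightarrow> frac (t + real i * d) = frac t + real i * d"
    using exists_no_wrap_cells[OF n(2)] by blast
  obtain c X0 where c: "c > 0" "X0 > 0" and params: "\<And>\<alpha>. 0 < \<alpha> \<Longrightarrow> X0 \<le> ln (1 / \<alpha>) \<Longrightarrow> \<exists>M\<ge>1. \<exists>D\<ge>1.
    2 ^ n * \<alpha> * (2 ^ (n + 3)) ^ (D * L + 1) \<le> 1 / 4 \<and>
    2 ^ n * \<alpha> * (2 ^ (n + 3)) ^ (D * L + 1) * (3 * real D * 2 ^ (n + 2)) < (1 / (4 * real M)) ^ n \<and>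
    1 / real M ^ D \<le> exp (- (c * ln (1 / \<alpha>) ^ 2))"
    using parameters_exist[OF n(2), of L] L by auto
  \<comment> \<open>\<open>c\<close> serves for \<open>X \<ge> X0\<close>; for smaller
    \<open>X\<close> the value \<open>1 / X0\<close> gives \<open>c' * X ^ 2 \<le> X\<close>, so the
    bound \<open>\<alpha> = exp (- X)\<close> is enough.\<close>
  define c' where "c' = min c (1 / X0)"
  have c': "c' > 0" using c by (simp add: c'_def)
  have "rho_tilde k \<alpha> \<le> \<alpha> powr (c' * ln (1 / \<alpha>))" if \<alpha>: "0 < \<alpha>" "\<alpha> < 1 / 2" for \<alpha>
  proof -
    define X where "X = ln (1 / \<alpha>)"
    have X: "X > 0" "ln \<alpha> = - X" using \<alpha> by (auto simp: X_def ln_div)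
    have powr: "\<alpha> powr (c' * ln (1 / \<alpha>)) = exp (- (c' * X ^ 2))"
      using \<alpha> X by (simp add: powr_def X_def[symmetric] power2_eq_square)
    show ?thesis
    proof (cases "X0 \<le> X")
      case True
      then obtain M D where MD: "M \<ge> 1" "D \<ge> 1" "2 ^ n * \<alpha> * (2 ^ (n + 3)) ^ (D * L + 1) \<le> 1 / 4"
        "2 ^ n * \<alpha> * (2 ^ (n + 3)) ^ (D * L + 1) * (3 * real D * 2 ^ (n + 2)) < (1 / (4 * real M)) ^ n"
        "1 / real M ^ D \<le> exp (- (c * X ^ 2))"
        using params[OF \<alpha>(1)] unfolding X_def by blast
      have "rho_tilde k \<alpha> \<le> Lambda_tilde k (strip (offset n L M D) \<alpha>)"
        using \<alpha> L MD by (intro rho_tilde_le range_strip riemann_integrable_offset_strip constant_first_marginal_strip) auto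
      also have "\<dots> \<le> 1 / real M ^ D"
        unfolding n(1) by (rule Lambda_tilde_offset_strip_le[OF n(2,3) L MD(2,1) no_wrap MD(3,4)])
      also have "\<dots> \<le> exp (- (c * X ^ 2))" by (rule MD(5))
      also have "\<dots> \<le> exp (- (c' * X ^ 2))" by (simp add: c'_def mult_right_mono)
      finally show ?thesis by (simp only: powr)
    next
      case False
      have "c' * X \<le> 1 / X0 * X" using X by (intro mult_right_mono) (auto simp: c'_def)
      also have "\<dots> \<le> 1" using False c by simp
      finally have "c' * X ^ 2 \<le> X" using X by (simp add: power2_eq_square mult_left_le_one_le flip: mult.assoc)
      have "rho_tilde k \<alpha> \<le> \<alpha>" using assms \<alpha> by (intro rho_tilde_le_density) auto
      also have "\<alpha> = exp (- X)" using \<alpha> by (simp flip: X(2))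
      also have "\<dots> \<le> exp (- (c' * X ^ 2))" using \<open>c' * X ^ 2 \<le> X\<close> by simp
      finally show ?thesis by (simp only: powr)
    qed
  qed
  then show ?thesis using c' by blast
qed

end
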